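(* Up to isomorphism, there are exactly $6$ finite groups in the class of groups $G(A)$ generated by invertible automata $A$ with $3$ states over a $2$-letter alphabet, namely: $\{1\}$ (generated by automaton number $1$), $C_2$ (automaton number $1090$), $C_2\times C_2$ (automaton number $730$), $D_4$ (automaton number $847$), $C_2\times C_2\times C_2$ (automaton number $802$), and $D_4\times C_2$ (automaton number $748$).
   Context: A finite invertible automaton is a quadruple $A=(Q,X,\tau,\rho)$ where $Q$ is a finite set of states, $X$ is a finite alphabet, $\tau:Q\times X\to Q$ and $\rho:Q\times X\to X$ are maps such that for each $q\in Q$ the map $\rho_q:X\to X$, $\rho_q(x)=\rho(q,x)$, is a permutation of $X$. Each state $q$ defines an automorphism, also denoted $q$, of the rooted tree $X^*$ of finite words over $X$, recursively by $q(\emptyset)=\emptyset$ and $q(xw)=\rho_q(x)\,\tau(q,x)(w)$ for $x\in X$, $w\in X^*$. The automaton group $G(A)$ is the subgroup of $\mathrm{Aut}(X^* )$ generated by the automorphisms defined by the states. Here $|Q|=3$ and $|X|=2$; distinct states are allowed to define the same automorphism. $C_2$ is the cyclic group of order $2$ and $D_4$ is the dihedral group of order $8$. Notation for specific automata: $X=\{0,1\}$, $Q=\{a,b,c\}$; $\sigma$ denotes the transposition of $0$ and $1$; $q=\sigma(r,s)$ (respectively $q=(r,s)$) means $\rho_q=\sigma$ (respectively $\rho_q$ is the identity), $\tau(q,0)=r$, $\tau(q,1)=s$. The numbered automata are: number $1$: $a=(a,a),\ b=(a,a),\ c=(a,a)$; number $1090$: $a=\sigma(a,a),\ b=(b,b),\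 c=(b,b)$; number $730$: $a=\sigma(a,a),\ b=(a,a),\ c=(a,a)$; number $847$: $a=\sigma(a,a),\ b=(b,b),\ c=(b,a)$; number $802$: $a=\sigma(a,a),\ b=(c,c),\ c=(a,a)$; number $748$: $a=\sigma(a,a),\ b=(c,a),\ c=(a,a)$. *)

theory Defs
  imports "HOL-Algebra.Elementary_Groups" "HOL-Algebra.Bij"
begin

record ('q, 'x) automaton =
  states :: "'q set"
  alphabet :: "'x set"
  trans_map :: "'q \<Rightarrow> 'x \<Rightarrow> 'q"
  out_map :: "'q \<Rightarrow> 'x \<Rightarrow> 'x"

definition finite_invertible_automaton :: "('q, 'x) automaton \<Rightarrow> bool" where
  "finite_invertible_automaton A \<longleftrightarrow>
     finite (states A) \<and> finite (alphabet A) \<and>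
     (\<forall>q\<in>states A. \<forall>x\<in>alphabet A. trans_map A q x \<in> states A) \<and>
     (\<forall>q\<in>states A. bij_betw (out_map A q) (alphabet A) (alphabet A))"

text \<open>
  The rooted tree \<open>X\<^sup>*\<close> has vertex set \<open>lists X\<close>, root \<open>[]\<close>, and an edge from \<open>u\<close> down to each
  \<open>u @ [x]\<close>. Elements of \<open>BijGroup (lists X)\<close> take the value \<open>undefined\<close> outside \<open>lists X\<close>, so
  that equality in the group is equality of maps on the tree.
\<close>

definition tree_auts :: "'x set \<Rightarrow> ('x list \<Rightarrow> 'x list) set" where
  "tree_auts X = {f \<in> Bij (lists X). f [] = [] \<and>
     (\<forall>u\<in>lists X. \<forall>v\<in>lists X. (\<exists>x. v = u @ [x]) \<longleftrightarrow> (\<exists>y. f v = f u @ [y]))}"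

definition tree_aut_group :: "'x set \<Rightarrow> ('x list \<Rightarrow> 'x list) monoid" where
  "tree_aut_group X = BijGroup (lists X) \<lparr>carrier := tree_auts X\<rparr>"

primrec word_action :: "('q, 'x) automaton \<Rightarrow> 'x list \<Rightarrow> 'q \<Rightarrow> 'x list" where
  "word_action A [] q = []"
| "word_action A (x # w) q = out_map A q x # word_action A w (trans_map A q x)"

definition state_aut :: "('q, 'x) automaton \<Rightarrow> 'q \<Rightarrow> 'x list \<Rightarrow> 'x list" where
  "state_aut A q = (\<lambda>w\<in>lists (alphabet A). word_action A w q)"

definition automaton_group :: "('q, 'x) automaton \<Rightarrow> ('x list \<Rightarrow> 'x list) monoid" where
  "automaton_group A =
     subgroup_generated (tree_aut_group (alphabet A)) (state_aut A ` states A)"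

text \<open>
  \<open>subgroup_generated G S\<close> only uses the part of \<open>S\<close> that lies in \<open>carrier G\<close>. The lemmas
  \<open>group_tree_aut_group\<close> and \<open>state_aut_in_tree_aut_group\<close> show that nothing is lost here and that
  inverses are taken in an actual group.
\<close>

lemma subgroup_tree_auts: "subgroup (tree_auts X) (BijGroup (lists X))"
proof (rule group.subgroupI [OF group_BijGroup])
  show "tree_auts X \<subseteq> carrier (BijGroup (lists X))"
    by (auto simp: tree_auts_def BijGroup_def)
  have "(\<lambda>x\<in>lists X. x) \<in> tree_auts X"
    by (auto simp: tree_auts_def id_Bij)
  then show "tree_auts X \<noteq> {}"
    by blast
next
  fix f assume f: "f \<in> tree_auts X"
  let ?g = "\<lambda>x\<in>lists X. inv_into (lists X) f x"
  have fB: "f \<in> Bij (lists X)"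
    using f by (simp add: tree_auts_def)
  have fbij: "bij_betw f (lists X) (lists X)"
    using fB by (simp add: Bij_def)
  have root: "?g [] = []"
    using f fbij by (auto simp: tree_auts_def bij_betw_def intro: inv_into_f_eq)
  have mem: "?g u \<in> lists X" and fg: "f (?g u) = u" if "u \<in> lists X" for u
    using that fbij fB by (simp_all add: Bij_inv_into_mem bij_betw_inv_into_right)
  have edges: "(\<exists>x. v = u @ [x]) \<longleftrightarrow> (\<exists>y. ?g v = ?g u @ [y])"
    if u: "u \<in> lists X" and v: "v \<in> lists X" for u v
  proof -
    have "(\<exists>x. ?g v = ?g u @ [x]) \<longleftrightarrow> (\<exists>y. f (?g v) = f (?g u) @ [y])"
      using f mem[OF u] mem[OF v] unfolding tree_auts_def by blast
    then show ?thesis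
      unfolding fg[OF u] fg[OF v] by blast
  qed
  have "?g \<in> tree_auts X"
    unfolding tree_auts_def using restrict_inv_into_Bij[OF fB] root edges by blast
  then show "inv\<^bsub>BijGroup (lists X)\<^esub> f \<in> tree_auts X"
    by (simp add: inv_BijGroup[OF fB])
next
  fix f g assume f: "f \<in> tree_auts X" and g: "g \<in> tree_auts X"
  have fB: "f \<in> Bij (lists X)" and gB: "g \<in> Bij (lists X)"
    using f g by (simp_all add: tree_auts_def)
  have gm: "g u \<in> lists X" if "u \<in> lists X" for u
    using Bij_imp_funcset[OF gB] that by blast
  have "(\<exists>x. v = u @ [x]) \<longleftrightarrow> (\<exists>y. f (g v) = f (g u) @ [y])"
    if u: "u \<in> lists X" and v: "v \<in> lists X" for u v
  proof -
    have "(\<exists>x. v = u @ [x]) \<longleftrightarrow> (\<exists>y. g v = g u @ [y])"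
      using g u v unfolding tree_auts_def by blast
    also have "\<dots> \<longleftrightarrow> (\<exists>y. f (g v) = f (g u) @ [y])"
      using f gm[OF u] gm[OF v] unfolding tree_auts_def by blast
    finally show ?thesis .
  qed
  moreover have "f (g []) = []"
    using f g by (simp add: tree_auts_def)
  ultimately have "compose (lists X) f g \<in> tree_auts X"
    using compose_Bij[OF fB gB] by (simp add: tree_auts_def compose_eq)
  then show "f \<otimes>\<^bsub>BijGroup (lists X)\<^esub> g \<in> tree_auts X"
    using fB gB by (simp add: BijGroup_def)
qed

lemma group_tree_aut_group: "group (tree_aut_group X)"
  unfolding tree_aut_group_def
  by (rule group.subgroup_imp_group [OF group_BijGroup subgroup_tree_auts])

lemma length_word_action [simp]: "length (word_action A w q) = length w"
  by (induction w arbitrary: q) auto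

lemma take_word_action: "take n (word_action A w q) = word_action A (take n w) q"
  by (induction w arbitrary: q n) (auto simp: take_Cons split: nat.splits)

lemma bij_betw_word_action:
  assumes A: "finite_invertible_automaton A" and "q \<in> states A"
  shows "bij_betw (\<lambda>w. word_action A w q) (lists (alphabet A)) (lists (alphabet A))"
proof -
  let ?X = "alphabet A"
  note outb = A[unfolded finite_invertible_automaton_def]
  have inj: "v = w"
    if "w \<in> lists ?X" "v \<in> lists ?X" "q \<in> states A" "word_action A v q = word_action A w q"
    for v w q
    using that
  proof (induction w arbitrary: v q rule: list.induct)
    case Nil
    then show ?case by (cases v) auto
  next
    case (Cons x w)
    then obtain y v' where v: "v = y # v'" by (cases v) auto
    with Cons.prems have "out_map A q y = out_map A q x" "x \<in> ?X" "y \<in> ?X"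
      by auto
    moreover have "inj_on (out_map A q) ?X"
      using outb Cons.prems by (auto simp: bij_betw_def)
    ultimately have "y = x"
      by (meson inj_onD)
    moreover have "trans_map A q x \<in> states A"
      using outb Cons.prems \<open>x \<in> ?X\<close> by blast
    ultimately show ?case
      using Cons v by auto
  qed
  have surj: "\<exists>v\<in>lists ?X. word_action A v q = w" if "w \<in> lists ?X" "q \<in> states A" for w q
    using that
  proof (induction w arbitrary: q rule: list.induct)
    case Nil
    then show ?case by (auto intro: bexI[of _ "[]"])
  next
    case (Cons y w)
    then have "y \<in> out_map A q ` ?X"
      using outb by (auto simp: bij_betw_def)
    then obtain x where x: "x \<in> ?X" "y = out_map A q x"
      by blast
    then have "trans_map A q x \<in> states A"
      using outb Cons.prems by blast
    then obtain v where "v \<in> lists ?X" "word_action A v (trans_map A q x) = w"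
      using Cons.IH[of "trans_map A q x"] Cons.prems by auto
    then show ?case
      using x by (intro bexI[of _ "x # v"]) auto
  qed
  have maps: "word_action A w q \<in> lists ?X" if "w \<in> lists ?X" "q \<in> states A" for w q
    using that
  proof (induction w arbitrary: q rule: list.induct)
    case (Cons x w)
    then show ?case
      using outb bij_betwE[of "out_map A q" ?X ?X] by auto
  qed simp
  show ?thesis
    unfolding bij_betw_def
  proof
    show "inj_on (\<lambda>w. word_action A w q) (lists ?X)"
      using inj assms(2) by (meson inj_onI)
    show "(\<lambda>w. word_action A w q) ` lists ?X = lists ?X"
    proof
      show "(\<lambda>w. word_action A w q) ` lists ?X \<subseteq> lists ?X"
        using maps assms(2) by blast
      show "lists ?X \<subseteq> (\<lambda>w. word_action A w q) ` lists ?X"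
        using surj[OF _ assms(2)] by force
    qed
  qed
qed

lemma state_aut_in_tree_aut_group:
  assumes "finite_invertible_automaton A" and "q \<in> states A"
  shows "state_aut A q \<in> carrier (tree_aut_group (alphabet A))"
proof -
  let ?X = "alphabet A"
  note b = bij_betw_word_action[OF assms]
  have child: "(\<exists>x. v = u @ [x]) \<longleftrightarrow> length v = Suc (length u) \<and> take (length u) v = u"
    for u v :: "'b list"
  proof
    assume *: "length v = Suc (length u) \<and> take (length u) v = u"
    then have "length (drop (length u) v) = Suc 0"
      by simp
    then obtain x where "drop (length u) v = [x]"
      unfolding length_Suc_conv by auto
    then show "\<exists>x. v = u @ [x]"
      using * append_take_drop_id[of "length u" v] by metis
  qed auto
  have "(\<exists>x. v = u @ [x]) \<longleftrightarrow> (\<exists>y. word_action A v q = word_action A u q @ [y])"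
    if u: "u \<in> lists ?X" and v: "v \<in> lists ?X" for u v
  proof -
    have "take (length u) v \<in> lists ?X"
      using v by (auto dest: in_set_takeD)
    then have "word_action A (take (length u) v) q = word_action A u q \<longleftrightarrow> take (length u) v = u"
      using inj_on_eq_iff[OF bij_betw_imp_inj_on[OF b], of "take (length u) v" u] u by blast
    then show ?thesis
      by (simp add: child take_word_action)
  qed
  moreover have "state_aut A q \<in> Bij (lists ?X)"
    using b unfolding state_aut_def Bij_def by (simp cong: bij_betw_cong)
  ultimately show ?thesis
    by (simp add: tree_aut_group_def tree_auts_def state_aut_def)
qed

text \<open>
  The dihedral group of order \<open>2 * n\<close>: \<open>(i, s)\<close> stands for \<open>r\<^sup>i t\<^sup>s\<close> with \<open>r\<close> a rotation of order
  \<open>n\<close>, \<open>t\<close> a reflection, and \<open>t r = r\<^sup>-\<^sup>1 t\<close>. The index of \<open>D\<^sub>4\<close> is \<open>n = 4\<close>.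
\<close>

definition dihedral_group :: "nat \<Rightarrow> (int \<times> bool) monoid" where
  "dihedral_group n =
     \<lparr>carrier = {0..<int n} \<times> UNIV,
      monoid.mult = (\<lambda>(i, s) (j, t). ((if s then i - j else i + j) mod int n, s \<noteq> t)),
      one = (0, False)\<rparr>"

lemma group_dihedral_group: "n > 0 \<Longrightarrow> group (dihedral_group n)"
proof (rule groupI)
  fix x assume n: "n > 0" and "x \<in> carrier (dihedral_group n)"
  then obtain i s where x: "x = (i, s)" "0 \<le> i" "i < int n"
    by (auto simp: dihedral_group_def)
  let ?y = "(if s then i else (- i) mod int n, s)"
  have "?y \<in> carrier (dihedral_group n)"
    using n x by (simp add: dihedral_group_def)
  moreover have "?y \<otimes>\<^bsub>dihedral_group n\<^esub> x = \<one>\<^bsub>dihedral_group n\<^esub>"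
    using x by (cases s) (simp_all add: dihedral_group_def mod_add_left_eq)
  ultimately show "\<exists>y\<in>carrier (dihedral_group n). y \<otimes>\<^bsub>dihedral_group n\<^esub> x = \<one>\<^bsub>dihedral_group n\<^esub>"
    by blast
next
  fix x y z :: "int \<times> bool"
  obtain i s j t k u where "x = (i, s)" "y = (j, t)" "z = (k, u)"
    by (metis surj_pair)
  then show "x \<otimes>\<^bsub>dihedral_group n\<^esub> y \<otimes>\<^bsub>dihedral_group n\<^esub> z =
        x \<otimes>\<^bsub>dihedral_group n\<^esub> (y \<otimes>\<^bsub>dihedral_group n\<^esub> z)"
    by (cases s; cases t)
       (simp_all add: dihedral_group_def mod_add_left_eq mod_add_right_eq mod_diff_left_eq
          mod_diff_right_eq add.assoc diff_diff_eq add_diff_eq diff_add_eq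
          diff_diff_eq2)
qed (auto simp: dihedral_group_def)

datatype state3 = Sa | Sb | Sc

definition perm_state :: "state3 \<Rightarrow> state3 \<Rightarrow> bool \<times> state3 \<times> state3" (\<open>\<sigma>'(_,/ _')\<close>) where
  "\<sigma>(r, s) = (True, r, s)"

definition id_state :: "state3 \<Rightarrow> state3 \<Rightarrow> bool \<times> state3 \<times> state3" (\<open>\<iota>'(_,/ _')\<close>) where
  "\<iota>(r, s) = (False, r, s)"

text \<open>
  \<open>automaton3 wa wb wc\<close> is the automaton over \<open>{0, 1}\<close> with states \<open>a = wa\<close>, \<open>b = wb\<close>, \<open>c = wc\<close>,
  where \<open>\<sigma>(r, s)\<close> is a state acting on letters by the transposition of \<open>0\<close> and \<open>1\<close>, and \<open>\<iota>(r, s)\<close>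
  (usually written \<open>(r, s)\<close>) a state acting trivially on letters.
\<close>

definition automaton3 ::
  "bool \<times> state3 \<times> state3 \<Rightarrow> bool \<times> state3 \<times> state3 \<Rightarrow> bool \<times> state3 \<times> state3 \<Rightarrow>
   (state3, nat) automaton" where
  "automaton3 wa wb wc =
     (let w = (\<lambda>q. case q of Sa \<Rightarrow> wa | Sb \<Rightarrow> wb | Sc \<Rightarrow> wc) in
      \<lparr>states = {Sa, Sb, Sc},
       alphabet = {0, 1},
       trans_map = (\<lambda>q x. case w q of (_, r, s) \<Rightarrow> if x = 0 then r else s),
       out_map = (\<lambda>q x. case w q of (swap, _, _) \<Rightarrow> if swap then 1 - x else x)\<rparr>)"

lemma automaton3_in_class:
  "finite_invertible_automaton (automaton3 wa wb wc)"
  "card (states (automaton3 wa wb wc)) = 3"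
  "card (alphabet (automaton3 wa wb wc)) = 2"
proof -
  let ?A = "automaton3 wa wb wc"
  have states: "states ?A = UNIV" and alphabet: "alphabet ?A = {0, 1}"
    using state3.exhaust by (auto simp: automaton3_def Let_def)
  have "bij_betw (out_map ?A q) {0, 1} {0, 1}" for q
  proof -
    obtain swap where "out_map ?A q = (\<lambda>x. if swap then 1 - x else x)"
      by (cases "(case q of Sa \<Rightarrow> wa | Sb \<Rightarrow> wb | Sc \<Rightarrow> wc)") (auto simp: automaton3_def Let_def)
    then show ?thesis
      by (cases swap) (auto simp: bij_betw_def inj_on_def)
  qed
  moreover have "finite (states ?A)"
    by (simp add: automaton3_def Let_def)
  ultimately show "finite_invertible_automaton ?A"
    by (simp add: finite_invertible_automaton_def states alphabet)
qed (simp_all add: automaton3_def Let_def)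

definition "automaton_1 = automaton3 \<iota>(Sa, Sa) \<iota>(Sa, Sa) \<iota>(Sa, Sa)"
definition "automaton_1090 = automaton3 \<sigma>(Sa, Sa) \<iota>(Sb, Sb) \<iota>(Sb, Sb)"
definition "automaton_730 = automaton3 \<sigma>(Sa, Sa) \<iota>(Sa, Sa) \<iota>(Sa, Sa)"
definition "automaton_847 = automaton3 \<sigma>(Sa, Sa) \<iota>(Sb, Sb) \<iota>(Sb, Sa)"
definition "automaton_802 = automaton3 \<sigma>(Sa, Sa) \<iota>(Sc, Sc) \<iota>(Sa, Sa)"
definition "automaton_748 = automaton3 \<sigma>(Sa, Sa) \<iota>(Sc, Sa) \<iota>(Sa, Sa)"

abbreviation "C2 \<equiv> integer_mod_group 2"
abbreviation "D4 \<equiv> dihedral_group 4"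

text \<open>
  The groups \<open>G(A)\<close> that are finite, \<open>A\<close> ranging over the 3-state automata with state set and
  alphabet taken from the given types. Up to renaming states and letters (hence up to isomorphism
  of \<open>G(A)\<close>) the types \<open>state3\<close> and \<open>nat\<close> already account for all such automata.
\<close>

definition finite_automaton_groups_3_2 ::
  "'q itself \<Rightarrow> ('x list \<Rightarrow> 'x list) monoid set" where
  "finite_automaton_groups_3_2 _ =
     {automaton_group A | A :: ('q, 'x) automaton.
        finite_invertible_automaton A \<and> card (states A) = 3 \<and> card (alphabet A) = 2 \<and>
        finite (carrier (automaton_group A))}"

definition iso_rel :: "'a monoid set \<Rightarrow> ('a monoid \<times> 'a monoid) set" where
  "iso_rel \<G> = {(G, H). G \<in> \<G> \<and> H \<in> \<G> \<and> G \<cong> H}"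

end

theory Submission
  imports Defs
begin

text \<open>
  An automaton over two letters with three states is coded by a table over \<open>bool\<close>, one entry per
  state. Suppose that its group is finite. Then the group does not act transitively on every level of
  the tree and all its elements have finite order, which excludes three patterns: a set \<open>K\<close> of
  states, contained in the set of sections of \<open>K\<close>, such that the first letter of a word can be changed
  alone by elements of the group generated by \<open>K\<close> (this makes all levels transitive and is visible
  either on one letter, from a section shared by an active and an inactive state, or on two letters);
  and an active word \<open>w\<close> such that the section of \<open>w\<^sup>2\<close> has the same state multiplicities modulo 2 as
  \<open>w\<close>. An exhaustive check of the \<open>18\<^sup>3\<close> tables shows that in the absence of these patterns the states
  generate a quotient of \<open>D\<^sub>4 \<times> C\<^sub>2\<close>; the quotients of \<open>D\<^sub>4 \<times> C\<^sub>2\<close> are the six groups of the theorem.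
\<close>

section \<open>Quotients of \<open>D\<^sub>4 \<times> C\<^sub>2\<close>\<close>

lemma DirProd_cong_iso:
  assumes "group G" "group H" "G \<cong> G'" "H \<cong> H'"
  shows "G \<times>\<times> H \<cong> G' \<times>\<times> H'"
proof -
  from assms obtain f g where "f \<in> iso G G'" "g \<in> iso H H'"
    unfolding is_iso_def by blast
  then have "(\<lambda>(x, y). (f x, g y)) \<in> iso (G \<times>\<times> H) (G' \<times>\<times> H')"
    using assms by (simp add: iso_paired2)
  then show ?thesis
    by (rule is_isoI)
qed

lemma DirProd_commute_iso: "G \<times>\<times> H \<cong> H \<times>\<times> G"
  by (rule is_isoI[of "\<lambda>(x, y). (y, x)"])
     (auto simp: iso_def hom_def bij_betw_def inj_on_def image_iff)

lemma DirProd_trivial_iso: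
  assumes "trivial_group H"
  shows "G \<times>\<times> H \<cong> G"
  using assms unfolding trivial_group_def
  by (intro is_isoI[of fst]) (auto simp: iso_def hom_def bij_betw_def inj_on_def image_iff)

text \<open>The inclusions force the image of \<open>\<phi>\<close> to be exactly
  \<open>generate G S\<close>. A model group is thus recognised from an explicit embedding, with the
  containments checked only on the generators and on the image.\<close>

lemma (in group) subgroup_generated_iso:
  assumes "group H" and \<phi>: "\<phi> \<in> hom H G" "inj_on \<phi> (carrier H)"
    and "S \<subseteq> \<phi> ` carrier H" and sub: "\<phi> ` carrier H \<subseteq> generate G S"
  shows "subgroup_generated G S \<cong> H"
proof -
  interpret \<phi>: group_hom H G \<phi>
    using assms is_group by (simp add: group_hom_def group_hom_axioms_def)
  have "S \<subseteq> carrier G"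
    using assms(4) \<phi>(1) by (auto simp: hom_def)
  then have carr: "carrier (subgroup_generated G S) = generate G S"
    by (simp add: carrier_subgroup_generated Int_absorb1)
  have "generate G S \<subseteq> \<phi> ` carrier H"
    using \<phi>.img_is_subgroup assms(4) by (simp add: generate_subgroup_incl)
  then have "\<phi> ` carrier H = carrier (subgroup_generated G S)"
    using sub carr by auto
  moreover from this have "\<phi> \<in> hom H (subgroup_generated G S)"
    using \<phi>(1) by (auto simp: hom_def)
  ultimately have "H \<cong> subgroup_generated G S"
    using \<phi>(2) by (intro is_isoI) (auto simp: iso_def bij_betw_def)
  then show ?thesis
    using \<open>group H\<close> group.iso_sym by blast
qed

text \<open>The induction checks that the centralizer of \<open>z\<close> is closed under products
  and inverses.\<close>

lemma (in group) commutes_generate: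
  assumes "h \<in> generate G S" "S \<subseteq> carrier G" "z \<in> carrier G" "\<And>s. s \<in> S \<Longrightarrow> s \<otimes> z = z \<otimes> s"
  shows "h \<otimes> z = z \<otimes> h"
  using assms(1)
proof induction
  case one
  then show ?case using assms by simp
next
  case (incl s)
  then show ?case using assms by simp
next
  case (inv s)
  then have s: "s \<in> carrier G" "s \<otimes> z = z \<otimes> s"
    using assms by auto
  have "s \<otimes> z \<otimes> inv s = z \<otimes> (s \<otimes> inv s)"
    using s \<open>z \<in> carrier G\<close> by (simp add: m_assoc)
  then have "z = s \<otimes> (z \<otimes> inv s)"
    using s(1) \<open>z \<in> carrier G\<close> by (simp add: m_assoc)
  then show ?case
    using s \<open>z \<in> carrier G\<close> inv_solve_left[of "z \<otimes> inv s" s z] by simp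
next
  case (eng h1 h2)
  then have "h1 \<in> carrier G" "h2 \<in> carrier G"
    using generate_in_carrier assms(2) by auto
  then show ?case
    using eng \<open>z \<in> carrier G\<close> by (metis m_assoc)
qed

lemma (in group) subgroup_generated_insert_mem:
  assumes "S \<subseteq> carrier G" "z \<in> generate G S"
  shows "subgroup_generated G (insert z S) = subgroup_generated G S"
proof -
  have z: "z \<in> carrier G"
    using assms generate_in_carrier by blast
  have "generate G (insert z S) \<subseteq> generate G S"
    using assms generate_is_subgroup[OF assms(1)] generate.incl
    by (intro generate_subgroup_incl) auto
  moreover have "generate G S \<subseteq> generate G (insert z S)"
    by (rule mono_generate) auto
  ultimately show ?thesis
    using assms z by (simp add: subgroup_generated_def Int_absorb1)
qed

text \<open>An internal direct product: \<open>(k, h)\<close> goes to h z^k. This is a homomorphism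
  because \<open>z\<close> is a central involution, and it is injective because \<open>z\<close> is
  new.\<close>

lemma (in group) adjoin_central_involution:
  assumes S: "S \<subseteq> carrier G" and z: "z \<in> carrier G" "z \<otimes> z = \<one>"
    and comm: "\<And>s. s \<in> S \<Longrightarrow> s \<otimes> z = z \<otimes> s" and new: "z \<notin> generate G S"
  shows "subgroup_generated G (insert z S) \<cong> C2 \<times>\<times> subgroup_generated G S"
proof -
  let ?H = "subgroup_generated G S" and ?\<phi> = "\<lambda>(k :: int, h). if k = 0 then h else h \<otimes> z"
  have H: "carrier ?H = generate G S" "generate G S \<subseteq> carrier G"
    using S generate_incl by (auto simp: carrier_subgroup_generated Int_absorb1)
  have cz: "h \<otimes> z = z \<otimes> h" if "h \<in> generate G S" for h
    using that commutes_generate S z comm by blast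
  have C2: "carrier C2 = {0, 1}"
    by (auto simp: carrier_integer_mod_group)
  have zz: "h \<otimes> z \<otimes> (h' \<otimes> z) = h \<otimes> h'" "h \<otimes> z \<otimes> h' = h \<otimes> h' \<otimes> z"
    if "h \<in> generate G S" "h' \<in> generate G S" for h h'
  proof -
    have c: "h \<in> carrier G" "h' \<in> carrier G"
      using that H(2) by auto
    show "h \<otimes> z \<otimes> h' = h \<otimes> h' \<otimes> z"
      using cz[OF that(2)] c z by (simp add: m_assoc)
    then have "h \<otimes> z \<otimes> h' \<otimes> z = h \<otimes> h' \<otimes> (z \<otimes> z)"
      using c z by (simp add: m_assoc)
    then show "h \<otimes> z \<otimes> (h' \<otimes> z) = h \<otimes> h'"
      using c z by (simp add: m_assoc)
  qed
  have "group (C2 \<times>\<times> ?H)"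
    by (simp add: DirProd_group)
  moreover have hom: "?\<phi> \<in> hom (C2 \<times>\<times> ?H) G"
    by (rule homI) (use H z zz in \<open>auto simp: C2 m_assoc subset_iff\<close>)
  moreover have "inj_on ?\<phi> (carrier (C2 \<times>\<times> ?H))"
  proof -
    \<comment> \<open>A kernel element with nonzero first component would put \<open>z\<close> into
      \<open>generate G S\<close>.\<close>
    have "z = inv h" if "h \<in> generate G S" "h \<otimes> z = \<one>" for h
      using that H z using inv_equality[of z h] cz[of h] by (auto simp: subset_iff)
    then show ?thesis
      using new generate_m_inv_closed[OF S] is_group
      by (subst inj_on_one_iff'[OF hom \<open>group (C2 \<times>\<times> ?H)\<close>]) (auto simp: C2 H)
  qed
  moreover have "insert z S \<subseteq> ?\<phi> ` carrier (C2 \<times>\<times> ?H)"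
  proof -
    have "z = ?\<phi> (1, \<one>)" "\<And>s. s = ?\<phi> (0, s)"
      using z by auto
    moreover have "\<one> \<in> generate G S" "S \<subseteq> generate G S"
      by (auto intro: generate.one generate.incl)
    ultimately show ?thesis
      unfolding carrier_DirProd C2 H by blast
  qed
  moreover have "?\<phi> ` carrier (C2 \<times>\<times> ?H) \<subseteq> generate G (insert z S)"
  proof -
    have "generate G S \<subseteq> generate G (insert z S)"
      by (rule mono_generate) auto
    moreover have "z \<in> generate G (insert z S)"
      by (simp add: generate.incl)
    ultimately show ?thesis
      by (auto simp: C2 H intro!: generate.eng[of _ G _ z])
  qed
  ultimately show ?thesis
    by (rule subgroup_generated_iso)
qed

text \<open>The product \<open>r\<close> of the two involutions has order exactly 4 and is inverted
  by conjugation with \<open>x\<close>. Hence sending \<open>(i, s)\<close> to r^i x^s embeds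
  \<open>D4\<close>.\<close>

lemma (in group) dihedral_subgroup_generated:
  assumes xy: "x \<in> carrier G" "y \<in> carrier G" and inv: "x \<otimes> x = \<one>" "y \<otimes> y = \<one>"
    and four: "(x \<otimes> y) [^] (4 :: nat) = \<one>" and two: "(x \<otimes> y) [^] (2 :: nat) \<noteq> \<one>"
  shows "subgroup_generated G {x, y} \<cong> D4"
proof -
  define r where "r = x \<otimes> y"
  define f where "f s = (if s then x else \<one>)" for s
  let ?\<phi> = "\<lambda>(i :: int, s). r [^] i \<otimes> f s"
  have r: "r \<in> carrier G" and f: "f s \<in> carrier G" for s
    using xy by (auto simp: r_def f_def)
  have cancel: "x \<otimes> (x \<otimes> u) = u" "y \<otimes> (y \<otimes> u) = u" if "u \<in> carrier G" for u
    using that xy inv by (simp_all flip: m_assoc)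
  have "inv r = y \<otimes> x"
    using xy inv by (intro inv_equality) (simp_all add: r_def m_assoc cancel)
  then have "x \<otimes> r = inv r \<otimes> x"
    using xy inv by (simp add: r_def m_assoc cancel)
  have pow: "x \<otimes> u [^] n = v [^] n \<otimes> x"
    if "x \<otimes> u = v \<otimes> x" "u \<in> carrier G" "v \<in> carrier G" for u v and n :: nat
  proof (induction n)
    case (Suc n)
    have "x \<otimes> u [^] Suc n = (x \<otimes> u [^] n) \<otimes> u"
      using that xy by (simp add: m_assoc)
    also have "\<dots> = v [^] n \<otimes> (x \<otimes> u)"
      unfolding Suc using that xy by (simp add: m_assoc)
    also have "\<dots> = v [^] Suc n \<otimes> x"
      unfolding that(1) using that xy by (simp add: m_assoc)
    finally show ?case .
  qed (use xy in simp)
  have conj: "x \<otimes> r [^] j = r [^] (- j) \<otimes> x" for j :: int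
  proof (cases j rule: int_cases2)
    case (nonneg n)
    then show ?thesis
      using pow[OF \<open>x \<otimes> r = inv r \<otimes> x\<close>, of n] r by (simp add: int_pow_neg int_pow_int nat_pow_inv)
  next
    case (nonpos n)
    have "x \<otimes> inv r = r \<otimes> x"
      unfolding \<open>inv r = y \<otimes> x\<close> using xy by (simp add: r_def m_assoc)
    then show ?thesis
      using nonpos pow[of "inv r" r n] r by (simp add: int_pow_neg int_pow_int nat_pow_inv)
  qed
  have r4: "r [^] (i mod 4) = r [^] i" for i :: int
  proof -
    have "r [^] i = r [^] (4 * (i div 4)) \<otimes> r [^] (i mod 4)"
      using r by (simp add: int_pow_mult[symmetric])
    also have "r [^] (4 * (i div 4)) = (r [^] (4 :: int)) [^] (i div 4)"
      using r by (simp add: int_pow_pow)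
    also have "r [^] (4 :: int) = \<one>"
      using four int_pow_int[of G r 4] by (simp add: r_def)
    finally show ?thesis
      using r by simp
  qed
  have D4: "carrier D4 = {0..<4} \<times> UNIV" "group D4"
    using group_dihedral_group[of 4] by (simp_all add: dihedral_group_def)
  have hom: "?\<phi> \<in> hom D4 G"
  proof (rule homI)
    fix a b assume "a \<in> carrier D4" "b \<in> carrier D4"
    obtain i s j t where ab: "a = (i, s)" "b = (j, t)"
      by fastforce
    have "r [^] i \<otimes> f s \<otimes> (r [^] j \<otimes> f t) = r [^] (if s then i - j else i + j) \<otimes> f (s \<noteq> t)"
    proof (cases s)
      case True
      have "r [^] i \<otimes> x \<otimes> (r [^] j \<otimes> f t) = r [^] i \<otimes> (x \<otimes> r [^] j) \<otimes> f t"
        using xy r f by (simp add: m_assoc)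
      also have "\<dots> = (r [^] i \<otimes> r [^] (- j)) \<otimes> (x \<otimes> f t)"
        unfolding conj using xy r f by (simp add: m_assoc)
      also have "r [^] i \<otimes> r [^] (- j) = r [^] (i - j)"
        using r by (simp add: int_pow_mult[symmetric])
      finally show ?thesis
        using True inv xy by (simp add: f_def)
    qed (use r f in \<open>auto simp: f_def int_pow_mult m_assoc\<close>)
    then show "?\<phi> (a \<otimes>\<^bsub>D4\<^esub> b) = ?\<phi> a \<otimes> ?\<phi> b"
      unfolding ab by (simp add: dihedral_group_def r4)
  qed (use r f in auto)
  have inj: "inj_on ?\<phi> (carrier D4)"
  proof -
    have r2: "r [^] (2 :: int) \<noteq> \<one>"
      using two int_pow_int[of G r 2] by (simp add: r_def)
    \<comment> \<open>If r^i = 1 with 0 < i < 4, then i = 2 or 2i is 2 modulo 4; either way r^2 =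
      1.\<close>
    have "i = 0" if "0 \<le> i" "i < 4" "r [^] i = \<one>" for i :: int
    proof (rule ccontr)
      assume "i \<noteq> 0"
      then have "(2 * i) mod 4 = 2 \<or> i = 2"
        using that by presburger
      moreover have "r [^] (2 * i) = \<one>"
        using that r by (simp add: mult.commute[of 2] flip: int_pow_pow)
      ultimately show False
        using r2 r4[of "2 * i"] that by auto
    qed
    \<comment> \<open>Otherwise \<open>x\<close> would be a power of \<open>r\<close> and commute
      with it. As \<open>x\<close> also inverts \<open>r\<close>, this would give r^2 = 1.\<close>
    moreover have False if "r [^] i \<otimes> x = \<one>" for i :: int
    proof -
      have "x = inv (r [^] i)"
        using that r xy by (metis int_pow_closed inv_equality inv_inv)
      then have "x \<otimes> r = r \<otimes> x"
        using r int_pow_mult[of r "- i" 1] int_pow_mult[of r 1 "- i"]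
        by (simp add: int_pow_neg add.commute)
      then have "r = inv r"
        using \<open>x \<otimes> r = inv r \<otimes> x\<close> r xy by simp
      then have "r \<otimes> r = \<one>"
        by (metis r_inv r)
      then show False
        using r2 r int_pow_mult[of r 1 1] by simp
    qed
    ultimately show ?thesis
      unfolding inj_on_one_iff'[OF hom D4(2) is_group]
      by (auto simp: D4 f_def dihedral_group_def r split: if_splits)
  qed
  have gens: "{x, y} \<subseteq> ?\<phi> ` carrier D4"
  proof -
    \<comment> \<open>The preimage of \<open>y\<close>: y = x r = r^(-1) x = r^3 x.\<close>
    have "y = x \<otimes> r"
      using xy inv by (simp add: r_def flip: m_assoc)
    also have "\<dots> = r [^] (3 :: int) \<otimes> x"
      using conj[of 1] r4[of "- 1"] r by simp
    finally have "y = ?\<phi> (3, True)"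
      by (simp add: f_def)
    then have "y \<in> ?\<phi> ` carrier D4"
      by (rule image_eqI) (simp add: D4)
    moreover have "x = ?\<phi> (0, True)"
      using xy by (simp add: f_def)
    then have "x \<in> ?\<phi> ` carrier D4"
      by (rule image_eqI) (simp add: D4)
    ultimately show ?thesis
      by simp
  qed
  have image: "?\<phi> ` carrier D4 \<subseteq> generate G {x, y}"
  proof -
    have sub: "subgroup (generate G {x, y}) G"
      using xy by (intro generate_is_subgroup) auto
    have "r \<in> generate G {x, y}" "f s \<in> generate G {x, y}" for s
      by (auto simp: r_def f_def intro: generate.intros)
    then show ?thesis
      using subgroup.m_closed[OF sub] subgroup_int_pow_closed[OF sub] by auto
  qed
  show ?thesis
    by (rule subgroup_generated_iso[OF D4(2) hom inj gens image])
qed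

lemma (in group) subgroup_generated_empty_iso: "subgroup_generated G {} \<cong> singleton_group ()"
proof -
  have "generate G {} = {\<one>}"
    by (rule generate_empty)
  then show ?thesis
    by (intro is_isoI[of "\<lambda>_. ()"])
       (auto simp: iso_def hom_def bij_betw_def inj_on_def subgroup_generated_def singleton_group_def)
qed

lemma (in group) subgroup_generated_one [simp]:
  "S \<subseteq> carrier G \<Longrightarrow> subgroup_generated G (insert \<one> S) = subgroup_generated G S"
  by (simp add: subgroup_generated_insert_mem generate.one)

text \<open>Adjoining \<open>z\<close> changes nothing if \<open>z\<close> already lies in the
  generated group, and splits off a factor \<open>C2\<close> otherwise. Starting from the empty set
  of generators, this yields the elementary abelian cases one involution at a time.\<close>

lemma (in group) adjoin_central_involution_iso:
  assumes "S \<subseteq> carrier G" "z \<in> carrier G" "z \<otimes> z = \<one>" "\<And>s. s \<in> S \<Longrightarrow> s \<otimes> z = z \<otimes> s"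
    and "subgroup_generated G S \<cong> H"
  shows "subgroup_generated G (insert z S) \<cong> H \<or> subgroup_generated G (insert z S) \<cong> C2 \<times>\<times> H"
proof (cases "z \<in> generate G S")
  case True
  then show ?thesis
    using subgroup_generated_insert_mem assms by simp
next
  case False
  with assms have "subgroup_generated G (insert z S) \<cong> C2 \<times>\<times> subgroup_generated G S"
    by (intro adjoin_central_involution) auto
  also have "\<dots> \<cong> C2 \<times>\<times> H"
    using assms by (intro DirProd_cong_iso) simp_all
  finally show ?thesis ..
qed

lemma C2_times_singleton_iso: "G \<cong> C2 \<times>\<times> singleton_group () \<Longrightarrow> G \<cong> C2"
  by (erule iso_trans) (simp add: DirProd_trivial_iso)

lemma (in group) one_involution_iso:
  assumes "x \<in> carrier G" "x \<otimes> x = \<one>"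
  shows "subgroup_generated G {x} \<cong> singleton_group () \<or> subgroup_generated G {x} \<cong> C2"
  using adjoin_central_involution_iso[OF _ assms _ subgroup_generated_empty_iso] C2_times_singleton_iso
  by auto

lemma (in group) two_involutions_iso:
  assumes "x \<in> carrier G" "y \<in> carrier G" "x \<otimes> x = \<one>" "y \<otimes> y = \<one>" "x \<otimes> y = y \<otimes> x"
  shows "subgroup_generated G {x, y} \<cong> singleton_group () \<or> subgroup_generated G {x, y} \<cong> C2 \<or>
    subgroup_generated G {x, y} \<cong> C2 \<times>\<times> C2"
proof -
  note step = adjoin_central_involution_iso[of "{y}" x]
  consider "subgroup_generated G {y} \<cong> singleton_group ()" | "subgroup_generated G {y} \<cong> C2"
    using one_involution_iso[of y] assms by blast
  then show ?thesis
  proof cases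
    case 1
    from step[OF _ _ _ _ this] show ?thesis
      using assms C2_times_singleton_iso by auto
  next
    case 2
    from step[OF _ _ _ _ this] show ?thesis
      using assms C2_times_singleton_iso by auto
  qed
qed

lemma (in group) three_involutions_iso:
  assumes "x \<in> carrier G" "y \<in> carrier G" "z \<in> carrier G"
    and "x \<otimes> x = \<one>" "y \<otimes> y = \<one>" "z \<otimes> z = \<one>" and "x \<otimes> y = y \<otimes> x" "x \<otimes> z = z \<otimes> x" "y \<otimes> z = z \<otimes> y"
  shows "subgroup_generated G {x, y, z} \<cong> singleton_group () \<or> subgroup_generated G {x, y, z} \<cong> C2 \<or>
    subgroup_generated G {x, y, z} \<cong> C2 \<times>\<times> C2 \<or> subgroup_generated G {x, y, z} \<cong> C2 \<times>\<times> C2 \<times>\<times> C2"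
proof -
  have comm: "s \<otimes> x = x \<otimes> s" if "s \<in> {y, z}" for s
    using that assms by auto
  note step = adjoin_central_involution_iso[of "{y, z}" x, OF _ _ _ comm]
  consider "subgroup_generated G {y, z} \<cong> singleton_group ()" | "subgroup_generated G {y, z} \<cong> C2" | "subgroup_generated G {y, z} \<cong> C2 \<times>\<times> C2"
    using two_involutions_iso[of y z] assms by blast
  then show ?thesis
  proof cases
    case 1
    from step[OF _ _ _ _ this] show ?thesis
      using assms C2_times_singleton_iso by auto
  next
    case 2
    from step[OF _ _ _ _ this] show ?thesis
      using assms C2_times_singleton_iso by auto
  next
    case 3
    from step[OF _ _ _ _ this] show ?thesis
      using assms C2_times_singleton_iso by auto
  qed
qed

lemma (in group) dihedral_central_involution_iso:
  assumes "x \<in> carrier G" "y \<in> carrier G" "z \<in> carrier G"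
    and "x \<otimes> x = \<one>" "y \<otimes> y = \<one>" "z \<otimes> z = \<one>"
    and "(x \<otimes> y) [^] (4 :: nat) = \<one>" "(x \<otimes> y) [^] (2 :: nat) \<noteq> \<one>"
    and "x \<otimes> z = z \<otimes> x" "y \<otimes> z = z \<otimes> y"
  shows "subgroup_generated G {x, y, z} \<cong> D4 \<or> subgroup_generated G {x, y, z} \<cong> D4 \<times>\<times> C2"
proof -
  have "{x, y, z} = insert z {x, y}"
    by auto
  moreover have "subgroup_generated G (insert z {x, y}) \<cong> D4 \<or>
      subgroup_generated G (insert z {x, y}) \<cong> C2 \<times>\<times> D4"
    by (rule adjoin_central_involution_iso) (use assms dihedral_subgroup_generated in auto)
  ultimately show ?thesis
    using DirProd_commute_iso iso_trans by metis
qed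

text \<open>The inverse of x y is y x, and it is also x y itself.\<close>

lemma (in group) involutions_commute:
  assumes "x \<in> carrier G" "y \<in> carrier G" "x \<otimes> x = \<one>" "y \<otimes> y = \<one>" "x \<otimes> y \<otimes> (x \<otimes> y) = \<one>"
  shows "x \<otimes> y = y \<otimes> x"
proof -
  have "inv x = x" "inv y = y" "inv (x \<otimes> y) = x \<otimes> y"
    using assms by (simp_all add: inv_equality)
  then show ?thesis
    using assms by (simp add: inv_mult_group)
qed

text \<open>The relations present \<open>D4 \<times>\<times> C2\<close>, with reflections
  \<open>x\<close>, \<open>y\<close> and central \<open>z\<close>. If (x y)^2 = 1, all three
  involutions commute; otherwise \<open>x\<close> and \<open>y\<close> generate a full
  \<open>D4\<close>, and only the position of \<open>z\<close> remains open.\<close>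

lemma (in group) quotient_of_D4_times_C2:
  assumes "x \<in> carrier G" "y \<in> carrier G" "z \<in> carrier G"
    and "x \<otimes> x = \<one>" "y \<otimes> y = \<one>" "z \<otimes> z = \<one>" and "(x \<otimes> y) [^] (4 :: nat) = \<one>"
    and "x \<otimes> z = z \<otimes> x" "y \<otimes> z = z \<otimes> y" and K: "K = subgroup_generated G {x, y, z}"
  shows "K \<cong> singleton_group () \<or> K \<cong> C2 \<or> K \<cong> C2 \<times>\<times> C2 \<or> K \<cong> D4 \<or>
    K \<cong> C2 \<times>\<times> C2 \<times>\<times> C2 \<or> K \<cong> D4 \<times>\<times> C2"
proof (cases "(x \<otimes> y) [^] (2 :: nat) = \<one>")
  case True
  then have "x \<otimes> y = y \<otimes> x"
    using assms by (intro involutions_commute) (simp_all add: numeral_2_eq_2)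
  then show ?thesis
    using three_involutions_iso[of x y z] assms by blast
next
  case False
  then show ?thesis
    using dihedral_central_involution_iso[of x y z] assms by blast
qed

section \<open>Criteria for infinite groups\<close>

text \<open>An entry consists of the activity of a state and its sections at the letters 0 and 1,
  coded as \<open>False\<close> and \<open>True\<close>.\<close>

type_synonym table = "state3 \<Rightarrow> bool \<times> state3 \<times> state3"

definition flips :: "table \<Rightarrow> state3 \<Rightarrow> bool" where
  "flips t q = fst (t q)"

definition state_section :: "table \<Rightarrow> state3 \<Rightarrow> bool \<Rightarrow> state3" where
  "state_section t q y = (if y then snd (snd (t q)) else fst (snd (t q)))"

primrec run :: "table \<Rightarrow> bool list \<Rightarrow> state3 \<Rightarrow> bool list" where
  "run t [] q = []"
| "run t (y # u) q = (y \<noteq> flips t q) # run t u (state_section t q y)"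

primrec run_word :: "table \<Rightarrow> state3 list \<Rightarrow> bool list \<Rightarrow> bool list" where
  "run_word t [] u = u"
| "run_word t (q # w) u = run_word t w (run t u q)"

primrec odd_flips :: "table \<Rightarrow> state3 list \<Rightarrow> bool" where
  "odd_flips t [] = False"
| "odd_flips t (q # w) = (flips t q \<noteq> odd_flips t w)"

primrec word_section :: "table \<Rightarrow> state3 list \<Rightarrow> bool \<Rightarrow> state3 list" where
  "word_section t [] y = []"
| "word_section t (q # w) y = state_section t q y # word_section t w (y \<noteq> flips t q)"

lemma length_run [simp]: "length (run t u q) = length u"
  by (induction u arbitrary: q) auto

lemma run_word_Nil [simp]: "run_word t w [] = []"
  by (induction w) auto

lemma run_word_Cons: "run_word t w (y # u) = (y \<noteq> odd_flips t w) # run_word t (word_section t w y) u"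
  by (induction w arbitrary: y u) auto

lemma run_word_append: "run_word t (v @ w) u = run_word t w (run_word t v u)"
  by (induction v arbitrary: u) auto

lemma run_word_power: "run_word t (concat (replicate n w)) u = (run_word t w ^^ n) u"
proof (induction n arbitrary: u)
  case (Suc n)
  then show ?case
    by (simp add: run_word_append funpow_swap1)
qed simp

lemma inj_run: "run t u q = run t v q \<Longrightarrow> u = v"
proof (induction u arbitrary: v q)
  case Nil
  then show ?case by (cases v) auto
next
  case (Cons y u)
  then obtain z v' where v: "v = z # v'"
    by (cases v) auto
  then have "z = y"
    using Cons.prems by auto
  then show ?case
    using Cons.prems Cons.IH[of "state_section t q y" v'] v by simp
qed

lemma surj_run: "\<exists>v. run t v q = u"
proof (induction u arbitrary: q)
  case (Cons y u)
  obtain v where "run t v (state_section t q (y \<noteq> flips t q)) = u"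
    using Cons by blast
  then show ?case
    by (intro exI[of _ "(y \<noteq> flips t q) # v"]) auto
qed (intro exI[of _ "[]"], simp)

lemma inj_run_word: "inj (run_word t w)"
proof (rule injI)
  show "run_word t w u = run_word t w v \<Longrightarrow> u = v" for u v
    by (induction w arbitrary: u v) (auto dest: inj_run)
qed

definition trivial_word :: "table \<Rightarrow> state3 list \<Rightarrow> bool" where
  "trivial_word t w \<longleftrightarrow> (\<forall>u. run_word t w u = u)"

text \<open>The powers of an action are actions of repeated words, so by finiteness two of them
  coincide, and injectivity cancels the smaller power.\<close>

lemma run_word_torsion:
  assumes "finite (range (run_word t))"
  obtains m where "m > 0" "\<And>u. (run_word t w ^^ m) u = u"
proof -
  let ?f = "run_word t w"
  have "?f ^^ n = run_word t (concat (replicate n w))" for n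
    by (rule ext) (simp add: run_word_power)
  then have "(\<lambda>n. ?f ^^ n) ` UNIV \<subseteq> range (run_word t)"
    by blast
  then have "finite ((\<lambda>n. ?f ^^ n) ` UNIV)"
    using assms finite_subset by blast
  then have "\<not> inj (\<lambda>n. ?f ^^ n)"
    using finite_imageD infinite_UNIV_nat by blast
  then obtain i j where "i < j" "?f ^^ i = ?f ^^ j"
    by (metis injI linorder_neqE_nat)
  moreover have "?f ^^ j = ?f ^^ i \<circ> ?f ^^ (j - i)"
    using funpow_add[of i "j - i" ?f] \<open>i < j\<close> by simp
  ultimately have "(?f ^^ i) ((?f ^^ (j - i)) u) = (?f ^^ i) u" for u
    by (metis comp_apply)
  then have "(?f ^^ (j - i)) u = u" for u
    using inj_fn[OF inj_run_word] by (meson injD)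
  then show ?thesis
    using that[of "j - i"] \<open>i < j\<close> by simp
qed

section \<open>Orbits on words and transitivity on levels\<close>

definition reach :: "table \<Rightarrow> state3 set \<Rightarrow> bool list \<Rightarrow> bool list \<Rightarrow> bool" where
  "reach t K u v \<longleftrightarrow> (\<exists>w. set w \<subseteq> K \<and> run_word t w u = v)"

lemma reach_refl [simp]: "reach t K u u"
  unfolding reach_def by (rule exI[of _ "[]"]) simp

lemma reach_trans [trans]: "reach t K u v \<Longrightarrow> reach t K v w \<Longrightarrow> reach t K u w"
proof -
  assume "reach t K u v" "reach t K v w"
  then obtain p q where "set p \<subseteq> K" "run_word t p u = v" "set q \<subseteq> K" "run_word t q v = w"
    by (auto simp: reach_def)
  then show ?thesis
    unfolding reach_def by (intro exI[of _ "p @ q"]) (simp add: run_word_append)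
qed

lemma reach_run: "q \<in> K \<Longrightarrow> reach t K u (run t u q)"
  unfolding reach_def by (rule exI[of _ "[q]"]) simp

text \<open>Words contain no inverses of states, but in the finite case the inverse of an action is
  one of its positive powers.\<close>

lemma reach_sym:
  assumes "finite (range (run_word t))" "reach t K u v"
  shows "reach t K v u"
proof -
  obtain w where w: "set w \<subseteq> K" "run_word t w u = v"
    using assms(2) by (auto simp: reach_def)
  obtain m where m: "m > 0" "\<And>u. (run_word t w ^^ m) u = u"
    using run_word_torsion[OF assms(1)] by blast
  have "(run_word t w ^^ (m - 1)) (run_word t w u) = (run_word t w ^^ Suc (m - 1)) u"
    by (simp only: funpow_Suc_right comp_apply)
  then have "run_word t (concat (replicate (m - 1) w)) v = u"
    using m w(2) by (simp add: run_word_power del: funpow.simps)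
  then show ?thesis
    using w(1) unfolding reach_def by (intro exI[of _ "concat (replicate (m - 1) w)"]) auto
qed

lemma infinite_if_level_transitive:
  assumes "\<And>u v. length u = length v \<Longrightarrow> reach t K u v"
  shows "infinite (range (run_word t))"
proof
  \<comment> \<open>The level is chosen equal to the number n of actions: an orbit has at most n
    elements, while that level has 2^n words.\<close>
  let ?M = "range (run_word t)" and ?n = "card (range (run_word t))"
  assume fin: "finite ?M"
  have "{u :: bool list. length u = ?n} \<subseteq> (\<lambda>f. f (replicate ?n False)) ` ?M"
  proof
    fix u :: "bool list" assume "u \<in> {u. length u = ?n}"
    then obtain w where "run_word t w (replicate ?n False) = u"
      using assms[of "replicate ?n False" u] by (auto simp: reach_def)
    then show "u \<in> (\<lambda>f. f (replicate ?n False)) ` ?M"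
      by blast
  qed
  then have "card {u :: bool list. length u = ?n} \<le> ?n"
    using fin by (meson card_image_le card_mono finite_imageI le_trans)
  moreover have "card {u :: bool list. length u = ?n} = 2 ^ ?n"
    using card_lists_length_eq[of "UNIV :: bool set" ?n] by simp
  ultimately show False
    by (metis less_exp not_le)
qed

text \<open>Guarantees that a move of the tail by a state in \<open>K\<close> can be performed below
  some first letter. The letter is not prescribed, so the first letter must be correctable on its
  own.\<close>

definition self_replicating :: "table \<Rightarrow> state3 list \<Rightarrow> bool" where
  "self_replicating t K \<longleftrightarrow> list_all (\<lambda>q. list_ex (\<lambda>p. state_section t p False = q \<or> state_section t p True = q) K) K"

text \<open>Transitivity climbs from level to level: moves of the tail are lifted, and
  \<open>cross\<close> adjusts the first letter. Since the proof is by contradiction,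
  \<open>cross\<close> may assume finiteness, which makes \<open>reach\<close> symmetric.\<close>

lemma infinite_if_first_letter_free:
  assumes K: "self_replicating t K" "a \<in> set K" "flips t a"
    and cross: "\<And>y u. finite (range (run_word t)) \<Longrightarrow> reach t (set K) (False # y # u) (True # y # u)"
  shows "infinite (range (run_word t))"
proof
  assume fin: "finite (range (run_word t))"
  note sym = reach_sym[OF fin]
  let ?r = "reach t (set K)"
  have cross': "?r (x # u) (x' # u)" if u: "u \<noteq> []" for x x' u
  proof -
    obtain y u' where "u = y # u'"
      using u by (cases u) auto
    then have "?r (False # u) (True # u)"
      using cross[OF fin] by blast
    then show ?thesis
      using sym by (cases x; cases x') auto
  qed
  \<comment> \<open>To apply \<open>q\<close> to the tail below \<open>x\<close>, the first letter
    is changed to a letter \<open>y\<close> at which some \<open>p\<close> has section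
    \<open>q\<close>, then \<open>p\<close> is applied, and finally the first letter is changed back
    to \<open>x\<close>.\<close>
  have lift: "?r (x # u) (x # v)" if uv: "?r u v" and "u \<noteq> []" for x u v
  proof -
    obtain w where "set w \<subseteq> set K" "run_word t w u = v"
      using uv by (auto simp: reach_def)
    then show ?thesis
      using \<open>u \<noteq> []\<close>
    proof (induction w arbitrary: u)
      case (Cons q w)
      then obtain p y where p: "p \<in> set K" "state_section t p y = q"
        using K(1) by (fastforce simp: self_replicating_def list_all_iff list_ex_iff)
      have "run t u q \<noteq> []"
        using Cons.prems by (metis length_0_conv length_run)
      have "?r (x # u) (y # u)"
        using cross' Cons.prems by blast
      also have "?r \<dots> ((y \<noteq> flips t p) # run t u q)"
        using reach_run[OF p(1), of t "y # u"] p(2) by simp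
      also have "?r \<dots> (x # run t u q)"
        using cross' \<open>run t u q \<noteq> []\<close> by blast
      also have "?r \<dots> (x # v)"
        using Cons \<open>run t u q \<noteq> []\<close> by simp
      finally show ?case .
    qed simp
  qed
  have "?r u v" if "length u = length v" for u v
    using that
  proof (induction u v rule: list_induct2)
    case (Cons x u y v)
    show ?case
    proof (cases "u = []")
      \<comment> \<open>On the first level the tail is empty and \<open>cross\<close> says nothing;
        there the active state \<open>a\<close> exchanges the letters.\<close>
      case True
      then show ?thesis
        using Cons(1) reach_run[OF K(2), of t "[x]"] K(3) by (cases "x = y") auto
    next
      case False
      then show ?thesis
        using lift[OF Cons(2) False, of x] cross'[of v x y] Cons(1) reach_trans by fastforce
    qed
  qed simp
  then show False
    using infinite_if_level_transitive[of t "set K"] fin by blast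
qed

text \<open>
  If an active and an inactive state have a common section \<open>l\<close>, then \<open>0 l(u)\<close> and \<open>1 l(u)\<close>, or
  \<open>0 u\<close> and \<open>1 u\<close>, lie in one orbit: the first letter can be changed without touching the rest.
\<close>

definition shares_section :: "table \<Rightarrow> state3 list \<Rightarrow> bool" where
  "shares_section t K \<longleftrightarrow> self_replicating t K \<and>
     list_ex (\<lambda>p. flips t p \<and> list_ex (\<lambda>q. \<not> flips t q \<and>
       (state_section t p False = state_section t q False \<or> state_section t p False = state_section t q True \<or>
        state_section t p True = state_section t q False \<or> state_section t p True = state_section t q True)) K) K"

lemma infinite_if_shares_section:
  assumes "shares_section t K"
  shows "infinite (range (run_word t))"
proof -
  obtain p q x y where p: "p \<in> set K" "flips t p" and q: "q \<in> set K" "\<not> flips t q"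
    and l: "state_section t p x = state_section t q y"
    using assms unfolding shares_section_def list_ex_iff by blast
  have "reach t (set K) (False # u) (True # u)" if fin: "finite (range (run_word t))" for u
  proof -
    note sym = reach_sym[OF fin]
    \<comment> \<open>If the common section sits at the same letter in both states, one word has the
      two desired words as images; if it sits at different letters, the two words have a common
      image.\<close>
    have "reach t (set K) (y # u) ((\<not> y) # u)"
    proof (cases "x = y")
      case True
      obtain v where v: "run t v (state_section t q y) = u"
        using surj_run by blast
      have "reach t (set K) (y # v) (y # u)"
        using reach_run[OF q(1), of t "y # v"] q(2) v by simp
      moreover have "reach t (set K) (y # v) ((\<not> y) # u)"
        using reach_run[OF p(1), of t "y # v"] p(2) v l True by simp
      ultimately show ?thesis
        using sym reach_trans by blast
    next
      case False
      have "reach t (set K) (y # u) (y # run t u (state_section t q y))"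
        using reach_run[OF q(1), of t "y # u"] q(2) by simp
      moreover have "reach t (set K) ((\<not> y) # u) (y # run t u (state_section t q y))"
        using reach_run[OF p(1), of t "(\<not> y) # u"] p(2) l False by (cases x) auto
      ultimately show ?thesis
        using sym reach_trans by blast
    qed
    then show ?thesis
      using sym by (cases y) auto
  qed
  then show ?thesis
    using assms p by (intro infinite_if_first_letter_free[of t K p]) (auto simp: shares_section_def)
qed

definition run2 :: "table \<Rightarrow> state3 \<Rightarrow> bool \<Rightarrow> bool \<Rightarrow> bool \<times> bool \<times> state3" where
  "run2 t q x y = (x \<noteq> flips t q, y \<noteq> flips t (state_section t q x), state_section t (state_section t q x) y)"

lemma run_run2: "run2 t q x y = (x', y', r) \<Longrightarrow> run t (x # y # u) q = x' # y' # run t u r"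
  by (auto simp: run2_def)

abbreviation "all_states \<equiv> [Sa, Sb, Sc]"

text \<open>
  The same effect after reading two letters: \<open>0 y u\<close> and \<open>1 y u\<close> are moved to a common word (for the
  other second letter possibly only up to the first letter of an image with second letter \<open>y\<close>).
\<close>

definition folds :: "table \<Rightarrow> bool \<Rightarrow> bool" where
  "folds t y \<longleftrightarrow> self_replicating t all_states \<and> list_ex (flips t) all_states \<and>
     list_ex (\<lambda>p. list_ex (\<lambda>q. run2 t p False y = run2 t q True y) all_states) all_states \<and>
     list_ex (\<lambda>p. list_ex (\<lambda>q. run2 t p False (\<not> y) = run2 t q True (\<not> y) \<or>
       snd (run2 t p False (\<not> y)) = snd (run2 t q True (\<not> y)) \<and>
       fst (snd (run2 t p False (\<not> y))) = y) all_states) all_states"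

lemma UNIV_state3: "(UNIV :: state3 set) = {Sa, Sb, Sc}"
  using state3.exhaust by auto

lemma infinite_if_folds:
  assumes "folds t y"
  shows "infinite (range (run_word t))"
proof -
  obtain a where a: "flips t a"
    using assms by (auto simp: folds_def)
  have K: "set all_states = UNIV"
    by (simp add: UNIV_state3)
  have "reach t UNIV (False # z # u) (True # z # u)" if fin: "finite (range (run_word t))" for z u
  proof -
    note sym = reach_sym[OF fin]
    have r: "reach t UNIV (x # z # u) (x' # z' # run t u l)" if "run2 t q x z = (x', z', l)"
      for q x z x' z' l u
      using reach_run[of q UNIV t "x # z # u"] run_run2[OF that] by simp
    have eq: "reach t UNIV (False # z # u) (True # z # u)" if fold: "run2 t p False z = run2 t q True z"
      for p q z u
    proof -
      obtain x' z' l where p: "run2 t p False z = (x', z', l)"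
        by (rule prod_cases3)
      then have "run2 t q True z = (x', z', l)"
        using fold by simp
      then show ?thesis
        using reach_trans[OF r[OF p] sym[OF r]] by blast
    qed
    have y: "reach t UNIV (False # y # u) (True # y # u)" for u
      using assms eq unfolding folds_def list_ex_iff by blast
    moreover have "reach t UNIV (False # (\<not> y) # u) (True # (\<not> y) # u)"
    proof -
      obtain p q where "run2 t p False (\<not> y) = run2 t q True (\<not> y) \<or>
          snd (run2 t p False (\<not> y)) = snd (run2 t q True (\<not> y)) \<and> fst (snd (run2 t p False (\<not> y))) = y"
        using assms unfolding folds_def list_ex_iff by blast
      then show ?thesis
      proof
        assume "snd (run2 t p False (\<not> y)) = snd (run2 t q True (\<not> y)) \<and> fst (snd (run2 t p False (\<not> y))) = y"
        moreover obtain x1 z1 l1 where p: "run2 t p False (\<not> y) = (x1, z1, l1)"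
          by (rule prod_cases3)
        moreover obtain x2 z2 l2 where q: "run2 t q True (\<not> y) = (x2, z2, l2)"
          by (rule prod_cases3)
        ultimately have eqs: "z1 = y" "z2 = y" "l2 = l1"
          by auto
        have "reach t UNIV (False # (\<not> y) # u) (x1 # y # run t u l1)"
          using r[OF p] eqs by simp
        \<comment> \<open>Both images have second letter \<open>y\<close>, so the case settled
          before changes the first letter.\<close>
        also have "reach t UNIV \<dots> (x2 # y # run t u l1)"
          using y[of "run t u l1"] sym[OF y[of "run t u l1"]] by (cases x1; cases x2) simp_all
        also have "reach t UNIV \<dots> (True # (\<not> y) # u)"
          using sym[OF r[OF q]] eqs by simp
        finally show ?thesis .
      qed (use eq in blast)
    qed
    ultimately show ?thesis
      by (cases "z = y") auto
  qed
  then show ?thesis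
    using assms a by (intro infinite_if_first_letter_free[of t all_states a])
      (simp_all only: K folds_def UNIV_I)
qed

section \<open>State multiplicities modulo 2 and elements of infinite order\<close>

definition parity :: "state3 list \<Rightarrow> state3 \<Rightarrow> bool" where
  "parity w q \<longleftrightarrow> odd (count_list w q)"

text \<open>The standard bilinear form on F_2^3; inequality of booleans is addition.\<close>

definition dot :: "(state3 \<Rightarrow> bool) \<Rightarrow> (state3 \<Rightarrow> bool) \<Rightarrow> bool" where
  "dot f v \<longleftrightarrow> ((f Sa \<and> v Sa) \<noteq> ((f Sb \<and> v Sb) \<noteq> (f Sc \<and> v Sc)))"

lemma parity_simps:
  "\<not> parity [] q"
  "parity (p # w) q \<longleftrightarrow> (p = q) \<noteq> parity w q"
  "parity (v @ w) q \<longleftrightarrow> parity v q \<noteq> parity w q"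
  by (auto simp: parity_def)

lemma dot_parity [simp]:
  "\<not> dot f (parity [])"
  "dot f (parity (q # w)) \<longleftrightarrow> f q \<noteq> dot f (parity w)"
  by (simp add: dot_def parity_simps, cases q) (simp_all add: dot_def parity_simps, blast+)

lemma odd_flips_dot: "odd_flips t w \<longleftrightarrow> dot (flips t) (parity w)"
  by (induction w) simp_all

text \<open>The runs starting with \<open>False\<close> and \<open>True\<close> feed opposite
  letters to every state of the word. Each occurrence of a state therefore contributes both of its
  sections, one to each run, whatever the activities are, and the sum is linear in
  \<open>parity w\<close>.\<close>

lemma parity_sections:
  "(parity (word_section t w False) q \<noteq> parity (word_section t w True) q) \<longleftrightarrow>
     dot (\<lambda>p. (state_section t p False = q) \<noteq> (state_section t p True = q)) (parity w)"
proof (induction w)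
  case Nil
  show ?case
    unfolding word_section.simps using dot_parity(1) parity_simps(1) by blast
next
  case (Cons p w)
  let ?d = "\<lambda>y. parity (word_section t w y) q" and ?s = "\<lambda>y. state_section t p y = q"
  have *: "((?s False \<noteq> ?d (False \<noteq> flips t p)) \<noteq> (?s True \<noteq> ?d (True \<noteq> flips t p))) \<longleftrightarrow>
      ((?s False \<noteq> ?s True) \<noteq> (?d False \<noteq> ?d True))"
    by (cases "flips t p") auto
  show ?case
    unfolding word_section.simps dot_parity unfolding parity_simps * Cons by (rule refl)
qed

text \<open>
  \<open>v\<close> is the vector over \<open>F\<^sub>2\<close> of multiplicities of the states in a word \<open>w\<close>. It determines whether \<open>w\<close>
  is active, and if so, the vector of the section of \<open>w\<^sup>2\<close>. If this vector is again \<open>v\<close>, then halving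
  the exponent turns a relation \<open>w\<^sup>m = 1\<close> into a smaller one for a word with the same vector.
\<close>

definition odometer :: "table \<Rightarrow> (state3 \<Rightarrow> bool) \<Rightarrow> bool" where
  "odometer t v \<longleftrightarrow> dot (flips t) v \<and>
     list_all (\<lambda>q. dot (\<lambda>p. (state_section t p False = q) \<noteq> (state_section t p True = q)) v = v q) all_states"

lemma infinite_if_odometer:
  assumes "odometer t v"
  shows "infinite (range (run_word t))"
proof
  assume fin: "finite (range (run_word t))"
  have fixed: "dot (\<lambda>p. (state_section t p False = q) \<noteq> (state_section t p True = q)) v = v q" for q
    using assms by (cases q) (auto simp: odometer_def)
  have "\<exists>u. (run_word t w ^^ m) u \<noteq> u" if "m > 0" "parity w = v" for m w
    using that
  proof (induction m arbitrary: w rule: less_induct)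
    case (less m)
    have odd: "odd_flips t w"
      using assms less.prems by (simp add: odometer_def odd_flips_dot)
    \<comment> \<open>The section of the square of \<open>w\<close> at \<open>False\<close>: the
      first copy is active, so the second one reads \<open>True\<close>.\<close>
    let ?w = "word_section t w False @ word_section t w True"
    have "parity ?w = v"
      using parity_sections[of t w] less.prems fixed by (auto simp: fun_eq_iff parity_simps)
    have square: "(run_word t w ^^ (2 * k)) (False # u) = False # (run_word t ?w ^^ k) u" for k u
      by (induction k arbitrary: u) (simp_all add: odd run_word_Cons run_word_append)
    show ?case
    proof (cases "even m")
      case True
      then obtain k where k: "m = 2 * k"
        by blast
      with less \<open>parity ?w = v\<close> obtain u where "(run_word t ?w ^^ k) u \<noteq> u"
        by fastforce
      then show ?thesis
        using square[of k u] k by (intro exI[of _ "False # u"]) simp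
    next
      \<comment> \<open>An odd power of an active word already moves the one-letter word.\<close>
      case False
      then obtain k where "m = Suc (2 * k)"
        by (auto elim: oddE)
      moreover have "(run_word t ?w ^^ k) [] = []"
        by (induction k) auto
      ultimately show ?thesis
        using square[of k "[]"] odd by (intro exI[of _ "[False]"]) (simp add: run_word_Cons)
    qed
  qed
  \<comment> \<open>A word with vector \<open>v\<close>, using each state at most once.\<close>
  moreover have "parity (filter v all_states) = v"
    by (rule ext, case_tac x) (simp_all add: parity_simps)
  moreover obtain m where "m > 0" "\<And>u. (run_word t (filter v all_states) ^^ m) u = u"
    using run_word_torsion[OF fin] by blast
  ultimately show False
    by blast
qed

text \<open>The first argument is fuel; sections of words in \<open>seen\<close> always lie in \<open>seen\<close> or \<open>todo\<close>.\<close>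

fun trivial_closure :: "nat \<Rightarrow> table \<Rightarrow> state3 list list \<Rightarrow> state3 list list \<Rightarrow> bool" where
  "trivial_closure n t seen [] = True"
| "trivial_closure 0 t seen (w # todo) = False"
| "trivial_closure (Suc n) t seen (w # todo) =
    (if w \<in> set seen then trivial_closure (Suc n) t seen todo
     else \<not> odd_flips t w \<and>
       trivial_closure n t (w # seen) (word_section t w False # word_section t w True # todo))"

text \<open>Induction on the input: inactive words keep the first letter, and their sections stay in
  \<open>C\<close>.\<close>

lemma trivial_word_if_closed:
  assumes "\<And>w. w \<in> C \<Longrightarrow> \<not> odd_flips t w \<and> word_section t w False \<in> C \<and> word_section t w True \<in> C"
  shows "w \<in> C \<Longrightarrow> trivial_word t w"
proof -
  have "run_word t w u = u" if "w \<in> C" for u w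
    using that
  proof (induction u arbitrary: w)
    case (Cons y u)
    then show ?case
      using assms[of w] by (cases y) (auto simp: run_word_Cons)
  qed simp
  then show "w \<in> C \<Longrightarrow> trivial_word t w"
    by (simp add: trivial_word_def)
qed

lemma trivial_closure_sound:
  assumes "trivial_closure n t [] [w]"
  shows "trivial_word t w"
proof -
  have "\<exists>C. set seen \<union> set todo \<subseteq> C \<and>
      (\<forall>w\<in>C. \<not> odd_flips t w \<and> word_section t w False \<in> C \<and> word_section t w True \<in> C)"
    if "trivial_closure n t seen todo"
      and "\<forall>w\<in>set seen. \<not> odd_flips t w \<and>
        {word_section t w False, word_section t w True} \<subseteq> set seen \<union> set todo" for n seen todo
    using that
  proof (induction n t seen todo rule: trivial_closure.induct)
    case (1 n t seen)
    then show ?case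
      by (intro exI[of _ "set seen"]) auto
  next
    case (3 n t seen w todo)
    show ?case
    proof (cases "w \<in> set seen")
      case True
      have "\<exists>C. set seen \<union> set todo \<subseteq> C \<and>
          (\<forall>w\<in>C. \<not> odd_flips t w \<and> word_section t w False \<in> C \<and> word_section t w True \<in> C)"
        using True 3(3,4) by (intro 3(1)) auto
      then show ?thesis
        using True by auto
    next
      case False
      have "\<exists>C. set (w # seen) \<union> set (word_section t w False # word_section t w True # todo) \<subseteq> C \<and>
          (\<forall>w\<in>C. \<not> odd_flips t w \<and> word_section t w False \<in> C \<and> word_section t w True \<in> C)"
        using False 3(3,4) by (intro 3(2)) auto
      then show ?thesis
        by auto
    qed
  qed simp
  from this[OF assms] show ?thesis
    using trivial_word_if_closed[of _ t w] by auto
qed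

section \<open>Classification of the tables\<close>

text \<open>
  Words act from left to right. In the first case \<open>x\<close>, \<open>y\<close>, \<open>z\<close> are involutions; in the second one \<open>y\<close>
  is a rotation of order dividing 4, and \<open>x\<close> and the product of \<open>x\<close> and \<open>y\<close> are the reflections.
\<close>

definition D4_C2_relations :: "(state3 list \<Rightarrow> bool) \<Rightarrow> state3 \<Rightarrow> state3 \<Rightarrow> state3 \<Rightarrow> bool" where
  "D4_C2_relations triv x y z \<longleftrightarrow> triv [x, x] \<and> triv [z, z] \<and> triv [x, z, x, z] \<and>
     (triv [y, y] \<and> triv [y, z, y, z] \<and> triv [x, y, x, y, x, y, x, y] \<or>
      triv [y, y, y, y] \<and> triv [x, y, x, y] \<and> triv [y, z, y, y, y, z])"

lemma D4_C2_relations_mono: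
  assumes "D4_C2_relations T x y z" "\<And>w. T w \<Longrightarrow> T' w"
  shows "D4_C2_relations T' x y z"
  using assms unfolding D4_C2_relations_def by blast

definition state_orders :: "(state3 \<times> state3 \<times> state3) list" where
  "state_orders = [(Sa, Sb, Sc), (Sa, Sc, Sb), (Sb, Sa, Sc), (Sb, Sc, Sa), (Sc, Sa, Sb), (Sc, Sb, Sa)]"

text \<open>A set for \<open>shares_section\<close> needs an active and an inactive state, which
  leaves the four sets with at least two states. The lists for \<open>odometer\<close> are the seven
  nonzero vectors of F_2^3. The fuel 30 suffices for \<open>all_classified\<close> to
  succeed.\<close>

definition classified :: "table \<Rightarrow> bool" where
  "classified t \<longleftrightarrow>
     flips t Sa = flips t Sb \<and> flips t Sb = flips t Sc \<or>
     list_ex (shares_section t) [[Sa, Sb], [Sa, Sc], [Sb, Sc], [Sa, Sb, Sc]] \<or>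
     list_ex (\<lambda>(x, y, z). D4_C2_relations (\<lambda>w. trivial_closure 30 t [] [w]) x y z) state_orders \<or>
     list_ex (\<lambda>w. odometer t (\<lambda>q. q \<in> set w)) [[Sa], [Sb], [Sc], [Sa, Sb], [Sa, Sc], [Sb, Sc], [Sa, Sb, Sc]] \<or>
     list_ex (folds t) [False, True]"

definition entries :: "(bool \<times> state3 \<times> state3) list" where
  "entries = List.product [False, True] (List.product all_states all_states)"

lemma all_classified:
  "list_all (\<lambda>a. list_all (\<lambda>b. list_all (\<lambda>c. classified (case_state3 a b c)) entries) entries) entries"
  by code_simp

lemma classified: "classified t"
proof -
  have "t q \<in> set entries" for q
    by (cases "t q"; cases "fst (snd (t q))"; cases "snd (snd (t q))") (auto simp: entries_def)
  then have "classified (case_state3 (t Sa) (t Sb) (t Sc))"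
    using all_classified by (simp add: list_all_iff)
  moreover have "case_state3 (t Sa) (t Sb) (t Sc) = t"
    by (rule ext) (simp split: state3.split)
  ultimately show ?thesis
    by simp
qed

text \<open>Under equal activity it does not matter which state reads a letter: every state changes
  all letters, or every state changes none.\<close>

lemma trivial_word_if_equal_flips:
  assumes "flips t Sa = flips t Sb" "flips t Sb = flips t Sc" "even (length w)"
  shows "trivial_word t w"
proof -
  define c where "c = flips t Sa"
  have flips: "flips t q = c" for q
    using assms by (cases q) (simp_all add: c_def)
  have run: "run t u q = map (\<lambda>y. y \<noteq> c) u" for u q
    by (induction u arbitrary: q) (simp_all add: flips)
  have "run_word t w u = map (\<lambda>y. y \<noteq> (c \<and> odd (length w))) u" for u
    by (induction w arbitrary: u) (auto simp: run)
  then show ?thesis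
    using assms(3) by (simp add: trivial_word_def)
qed

lemma finite_imp_D4_C2_relations:
  assumes fin: "finite (range (run_word t))"
  obtains x y z where "{x, y, z} = UNIV" "D4_C2_relations (trivial_word t) x y z"
proof -
  have orders: "{x, y, z} = UNIV" if "(x, y, z) \<in> set state_orders" for x y z
    using that state3.exhaust by (auto simp: state_orders_def)
  have "\<exists>(x, y, z) \<in> set state_orders. D4_C2_relations (trivial_word t) x y z"
  proof (cases "flips t Sa = flips t Sb \<and> flips t Sb = flips t Sc")
    case True
    \<comment> \<open>All words in the relations have even length.\<close>
    then have "D4_C2_relations (trivial_word t) Sa Sb Sc"
      by (simp add: D4_C2_relations_def trivial_word_if_equal_flips)
    then show ?thesis
      by (simp add: state_orders_def)
  next
    case False
    have "\<not> list_ex (shares_section t) Ks" "\<not> list_ex (folds t) ys" "\<not> list_ex (\<lambda>w. odometer t (f w)) ws"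
      for Ks ys ws and f :: "state3 list \<Rightarrow> _"
      using fin infinite_if_shares_section infinite_if_odometer infinite_if_folds
      by (auto simp: list_ex_iff)
    then have "list_ex (\<lambda>(x, y, z). D4_C2_relations (\<lambda>w. trivial_closure 30 t [] [w]) x y z) state_orders"
      using classified[of t] False by (simp only: classified_def simp_thms)
    then obtain x y z where "(x, y, z) \<in> set state_orders"
      and rel: "D4_C2_relations (\<lambda>w. trivial_closure 30 t [] [w]) x y z"
      by (auto simp: list_ex_iff)
    moreover have "D4_C2_relations (trivial_word t) x y z"
      by (rule D4_C2_relations_mono[OF rel]) (rule trivial_closure_sound)
    ultimately show ?thesis
      by blast
  qed
  then show ?thesis
    using that orders by blast
qed

section \<open>From coded words to the automaton group\<close>

locale coded_automaton =
  fixes A :: "('q, 'x) automaton" and s :: "state3 \<Rightarrow> 'q" and e :: "bool \<Rightarrow> 'x" and t :: table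
  assumes invertible: "finite_invertible_automaton A"
    and s: "range s = states A" and e: "inj e" "range e = alphabet A"
    and out: "out_map A (s q) (e y) = e (y \<noteq> flips t q)"
    and trans: "trans_map A (s q) (e y) = s (state_section t q y)"
begin

abbreviation Aut where "Aut \<equiv> tree_aut_group (alphabet A)"

sublocale Aut: group Aut
  by (rule group_tree_aut_group)

text \<open>A product in \<open>Aut\<close> applies its right factor first, so the head of the word
  becomes the right factor, in agreement with \<open>run_word\<close>.\<close>

primrec word_aut :: "state3 list \<Rightarrow> 'x list \<Rightarrow> 'x list" where
  "word_aut [] = \<one>\<^bsub>Aut\<^esub>"
| "word_aut (q # w) = word_aut w \<otimes>\<^bsub>Aut\<^esub> state_aut A (s q)"

lemma state_aut_closed [simp, intro]: "state_aut A (s q) \<in> carrier Aut"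
  using state_aut_in_tree_aut_group[OF invertible] s by blast

lemma word_aut_closed [simp, intro]: "word_aut w \<in> carrier Aut"
  by (induction w) simp_all

lemma automaton_group_eq: "automaton_group A = subgroup_generated Aut (range (\<lambda>q. state_aut A (s q)))"
  unfolding automaton_group_def s[symmetric] by (simp add: image_image)

lemma word_aut_in_group: "word_aut w \<in> carrier (automaton_group A)"
proof -
  have "state_aut A (s q) \<in> carrier (automaton_group A)" for q
    unfolding automaton_group_eq carrier_subgroup_generated by (intro generate.incl) auto
  moreover have "subgroup (carrier (automaton_group A)) Aut"
    unfolding automaton_group_eq by (rule Aut.subgroup_subgroup_generated)
  ultimately show ?thesis
    by (induction w) (auto intro: subgroup.one_closed subgroup.m_closed)
qed

lemma alphabet_words: "w \<in> lists (alphabet A) \<longleftrightarrow> (\<exists>u. w = map e u)"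
  unfolding e(2)[symmetric] by (auto simp: in_lists_conv_set image_iff ex_map_conv subset_iff)

lemma word_aut_map: "word_aut w (map e u) = map e (run_word t w u)"
proof (induction w arbitrary: u)
  case Nil
  have "map e u \<in> lists (alphabet A)"
    using alphabet_words by blast
  then show ?case
    by (simp add: tree_aut_group_def BijGroup_def)
next
  case (Cons q w)
  have "map e u \<in> lists (alphabet A)"
    using alphabet_words by blast
  moreover have "word_action A (map e u) (s q) = map e (run t u q)"
    by (induction u arbitrary: q) (simp_all add: out trans)
  ultimately have "state_aut A (s q) (map e u) = map e (run t u q)"
    by (simp add: state_aut_def)
  moreover have "word_aut w \<in> Bij (lists (alphabet A))" "state_aut A (s q) \<in> Bij (lists (alphabet A))"
    using word_aut_closed[of w] state_aut_closed[of q] by (auto simp: tree_aut_group_def tree_auts_def)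
  ultimately show ?case
    using Cons \<open>map e u \<in> lists (alphabet A)\<close>
    by (simp add: tree_aut_group_def BijGroup_def compose_eq)
qed

lemma word_aut_eq_iff: "word_aut v = word_aut w \<longleftrightarrow> run_word t v = run_word t w"
proof
  assume "word_aut v = word_aut w"
  then have "map e (run_word t v u) = map e (run_word t w u)" for u
    by (simp flip: word_aut_map)
  then show "run_word t v = run_word t w"
    using e(1) by (auto simp: inj_map_eq_map)
next
  assume eq: "run_word t v = run_word t w"
  show "word_aut v = word_aut w"
  proof (rule extensionalityI)
    show "word_aut v \<in> extensional (lists (alphabet A))" "word_aut w \<in> extensional (lists (alphabet A))"
      using word_aut_closed[of v] word_aut_closed[of w]
      by (auto simp: tree_aut_group_def tree_auts_def Bij_def)
  qed (use eq alphabet_words word_aut_map in auto)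
qed

lemma word_aut_trivial: "trivial_word t w \<Longrightarrow> word_aut w = \<one>\<^bsub>Aut\<^esub>"
  using word_aut_eq_iff[of w "[]"] by (auto simp: trivial_word_def)

text \<open>Decoding letters recovers \<open>run_word t w\<close> from \<open>word_aut w\<close>, so
  the coded actions are an image of part of the group.\<close>

lemma finite_run_word:
  assumes "finite (carrier (automaton_group A))"
  shows "finite (range (run_word t))"
proof -
  have "map (inv_into UNIV e) (word_aut w (map e u)) = run_word t w u" for w u
    using e(1) by (simp add: word_aut_map map_idI)
  then have "run_word t w = (\<lambda>u. map (inv_into UNIV e) (word_aut w (map e u)))" for w
    by (simp add: fun_eq_iff)
  then have "range (run_word t) \<subseteq> (\<lambda>f u. map (inv_into UNIV e) (f (map e u))) ` carrier (automaton_group A)"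
    using word_aut_in_group by blast
  then show ?thesis
    using assms finite_surj by blast
qed

text \<open>Words separated by the test inputs \<open>us\<close> give different group elements. This
  makes lower bounds on the order a matter of evaluation.\<close>

lemma card_automaton_group_ge:
  assumes "finite (carrier (automaton_group A))" "distinct (map (\<lambda>w. map (run_word t w) us) ws)"
  shows "length ws \<le> card (carrier (automaton_group A))"
proof -
  have "inj_on word_aut (set ws)"
    using assms(2) by (auto simp: inj_on_def distinct_map word_aut_eq_iff)
  moreover have "distinct ws"
    using assms(2) by (simp add: distinct_map)
  ultimately have "length ws = card (word_aut ` set ws)"
    by (simp add: card_image distinct_card)
  also have "\<dots> \<le> card (carrier (automaton_group A))"
    using assms(1) word_aut_in_group by (intro card_mono) auto
  finally show ?thesis .
qed

lemma automaton_group_iso_if_relations: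
  assumes xyz: "{x, y, z} = UNIV" and rel: "D4_C2_relations (trivial_word t) x y z"
  shows "automaton_group A \<cong> singleton_group () \<or> automaton_group A \<cong> C2 \<or>
    automaton_group A \<cong> C2 \<times>\<times> C2 \<or> automaton_group A \<cong> D4 \<or>
    automaton_group A \<cong> C2 \<times>\<times> C2 \<times>\<times> C2 \<or> automaton_group A \<cong> D4 \<times>\<times> C2"
proof -
  let ?a = "\<lambda>q. state_aut A (s q)"
  let ?x = "?a x" and ?y = "?a y" and ?z = "?a z"
  note assoc = Aut.m_assoc
  have group: "automaton_group A = subgroup_generated Aut {?x, ?y, ?z}"
    unfolding automaton_group_eq xyz[symmetric] by simp
  have x: "?x \<otimes>\<^bsub>Aut\<^esub> ?x = \<one>\<^bsub>Aut\<^esub>" and z: "?z \<otimes>\<^bsub>Aut\<^esub> ?z = \<one>\<^bsub>Aut\<^esub>"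
    using rel word_aut_trivial[of "[x, x]"] word_aut_trivial[of "[z, z]"]
    by (auto simp: D4_C2_relations_def)
  have xz: "?x \<otimes>\<^bsub>Aut\<^esub> ?z = ?z \<otimes>\<^bsub>Aut\<^esub> ?x"
    using rel word_aut_trivial[of "[z, x, z, x]"] word_aut_trivial[of "[x, z, x, z]"] x z
    by (intro Aut.involutions_commute[symmetric]) (auto simp: D4_C2_relations_def assoc)
  consider (straight) "trivial_word t [y, y]" "trivial_word t [y, z, y, z]"
      "trivial_word t [x, y, x, y, x, y, x, y]"
    | (twisted) "trivial_word t [y, y, y, y]" "trivial_word t [x, y, x, y]" "trivial_word t [y, z, y, y, y, z]"
    using rel unfolding D4_C2_relations_def by blast
  then show ?thesis
  proof cases
    case straight
    have y: "?y \<otimes>\<^bsub>Aut\<^esub> ?y = \<one>\<^bsub>Aut\<^esub>"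
      using word_aut_trivial[OF straight(1)] by simp
    have yz: "?y \<otimes>\<^bsub>Aut\<^esub> ?z = ?z \<otimes>\<^bsub>Aut\<^esub> ?y"
      using word_aut_trivial[OF straight(2)] y z
      by (intro Aut.involutions_commute[symmetric]) (auto simp: assoc)
    \<comment> \<open>The product appears as y x because \<open>word_aut\<close> reverses
      words.\<close>
    have "(?y \<otimes>\<^bsub>Aut\<^esub> ?x) [^]\<^bsub>Aut\<^esub> (4 :: nat) = \<one>\<^bsub>Aut\<^esub>"
      using word_aut_trivial[OF straight(3)] by (simp add: eval_nat_numeral assoc)
    moreover have "automaton_group A = subgroup_generated Aut {?y, ?x, ?z}"
      unfolding group by (simp add: insert_commute)
    ultimately show ?thesis
      by (intro Aut.quotient_of_D4_times_C2[of ?y ?x ?z]) (simp_all add: x y z xz yz)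
  next
    case twisted
    \<comment> \<open>Here \<open>?y\<close> is the rotation and \<open>?u\<close> the second
      reflection; since \<open>?u\<close> times \<open>?x\<close> is \<open>?y\<close>, the
      generator \<open>?y\<close> can be exchanged for \<open>?u\<close>.\<close>
    let ?u = "?y \<otimes>\<^bsub>Aut\<^esub> ?x"
    have u: "?u \<otimes>\<^bsub>Aut\<^esub> ?u = \<one>\<^bsub>Aut\<^esub>"
      using word_aut_trivial[OF twisted(2)] by (simp add: assoc)
    have y4: "?y \<otimes>\<^bsub>Aut\<^esub> (?y \<otimes>\<^bsub>Aut\<^esub> (?y \<otimes>\<^bsub>Aut\<^esub> ?y)) = \<one>\<^bsub>Aut\<^esub>"
      using word_aut_trivial[OF twisted(1)] by (simp add: assoc)
    have ux: "?u \<otimes>\<^bsub>Aut\<^esub> ?x = ?y"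
      using x by (simp add: assoc)
    \<comment> \<open>The third relation reads z y^3 z y = 1. With z^2 = 1 this gives y^3 z y = z,
      and multiplying by y on the left and using y^4 = 1 gives z y = y z.\<close>
    have yz: "?y \<otimes>\<^bsub>Aut\<^esub> ?z = ?z \<otimes>\<^bsub>Aut\<^esub> ?y"
    proof -
      let ?v = "?y \<otimes>\<^bsub>Aut\<^esub> (?y \<otimes>\<^bsub>Aut\<^esub> (?y \<otimes>\<^bsub>Aut\<^esub> (?z \<otimes>\<^bsub>Aut\<^esub> ?y)))"
      have zv: "?z \<otimes>\<^bsub>Aut\<^esub> ?v = \<one>\<^bsub>Aut\<^esub>"
        using word_aut_trivial[OF twisted(3)] by (simp add: assoc)
      have "?v = (?z \<otimes>\<^bsub>Aut\<^esub> ?z) \<otimes>\<^bsub>Aut\<^esub> ?v"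
        unfolding z by simp
      also have "\<dots> = ?z \<otimes>\<^bsub>Aut\<^esub> (?z \<otimes>\<^bsub>Aut\<^esub> ?v)"
        by (rule assoc) simp_all
      also have "\<dots> = ?z"
        unfolding zv by simp
      finally have "?v = ?z" .
      then have "?y \<otimes>\<^bsub>Aut\<^esub> ?z = ?y \<otimes>\<^bsub>Aut\<^esub> ?v"
        by simp
      also have "\<dots> = (?y \<otimes>\<^bsub>Aut\<^esub> (?y \<otimes>\<^bsub>Aut\<^esub> (?y \<otimes>\<^bsub>Aut\<^esub> ?y))) \<otimes>\<^bsub>Aut\<^esub> (?z \<otimes>\<^bsub>Aut\<^esub> ?y)"
        by (simp add: assoc)
      finally show ?thesis
        unfolding y4 by simp
    qed
    have uz: "?u \<otimes>\<^bsub>Aut\<^esub> ?z = ?z \<otimes>\<^bsub>Aut\<^esub> ?u"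
    proof -
      have "?u \<otimes>\<^bsub>Aut\<^esub> ?z = (?y \<otimes>\<^bsub>Aut\<^esub> ?z) \<otimes>\<^bsub>Aut\<^esub> ?x"
        using xz by (simp add: assoc)
      then show ?thesis
        unfolding yz by (simp add: assoc)
    qed
    have "?u \<in> generate Aut {?x, ?y, ?z}"
      by (intro generate.eng generate.incl) auto
    then have "automaton_group A = subgroup_generated Aut (insert ?u {?x, ?y, ?z})"
      unfolding group by (intro Aut.subgroup_generated_insert_mem[symmetric]) auto
    also have "insert ?u {?x, ?y, ?z} = insert ?y {?u, ?x, ?z}"
      by auto
    also have "subgroup_generated Aut \<dots> = subgroup_generated Aut {?u, ?x, ?z}"
    proof (rule Aut.subgroup_generated_insert_mem)
      have "?u \<otimes>\<^bsub>Aut\<^esub> ?x \<in> generate Aut {?u, ?x, ?z}"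
        by (intro generate.eng generate.incl) auto
      then show "?y \<in> generate Aut {?u, ?x, ?z}"
        unfolding ux .
    qed auto
    finally have "automaton_group A = subgroup_generated Aut {?u, ?x, ?z}" .
    moreover have "(?u \<otimes>\<^bsub>Aut\<^esub> ?x) [^]\<^bsub>Aut\<^esub> (4 :: nat) = \<one>\<^bsub>Aut\<^esub>"
      unfolding ux using y4 by (simp add: eval_nat_numeral assoc)
    ultimately show ?thesis
      by (intro Aut.quotient_of_D4_times_C2[of ?u ?x ?z]) (simp_all only: x u z xz uz
        state_aut_closed Aut.m_closed)
  qed
qed

theorem finite_automaton_group_iso:
  assumes "finite (carrier (automaton_group A))"
  shows "automaton_group A \<cong> singleton_group () \<or> automaton_group A \<cong> C2 \<or>
    automaton_group A \<cong> C2 \<times>\<times> C2 \<or> automaton_group A \<cong> D4 \<or>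
    automaton_group A \<cong> C2 \<times>\<times> C2 \<times>\<times> C2 \<or> automaton_group A \<cong> D4 \<times>\<times> C2"
proof -
  obtain x y z where "{x, y, z} = UNIV" "D4_C2_relations (trivial_word t) x y z"
    by (rule finite_imp_D4_C2_relations[OF finite_run_word[OF assms]])
  then show ?thesis
    by (rule automaton_group_iso_if_relations)
qed

end

lemma coded_automaton_exists:
  assumes "finite_invertible_automaton A" "card (states A) = 3" "card (alphabet A) = 2"
  obtains s e t where "coded_automaton A s e t"
proof -
  obtain p q r where Q: "states A = {p, q, r}"
    using assms(2) by (auto simp: card_3_iff)
  obtain x y where X: "alphabet A = {x, y}" "x \<noteq> y"
    using assms(3) by (auto simp: card_2_iff)
  define s where "s = case_state3 p q r"
  define e where "e = (\<lambda>b. if b then y else x)"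
  have s: "range s = states A"
    unfolding Q s_def UNIV_state3 by simp
  have e: "inj e" "range e = alphabet A"
    using X by (auto simp: e_def inj_def UNIV_bool)
  have bij: "bij_betw (out_map A (s k)) (alphabet A) (alphabet A)" for k
    using assms(1) s unfolding finite_invertible_automaton_def by blast
  have closed: "trans_map A (s k) (e b) \<in> range s" for k b
    using assms(1) s e unfolding finite_invertible_automaton_def by blast
  \<comment> \<open>The letters \<open>x\<close> and \<open>y\<close> play the roles of 0 and 1;
    \<open>inv_into\<close> chooses codes for the target states.\<close>
  define t where "t = (\<lambda>k. (out_map A (s k) x = y, inv_into UNIV s (trans_map A (s k) x), inv_into UNIV s (trans_map A (s k) y)))"
  have "coded_automaton A s e t"
  proof
    show "trans_map A (s k) (e b) = s (state_section t k b)" for k b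
      using f_inv_into_f[OF closed[of k b]] by (auto simp: state_section_def t_def e_def)
    show "out_map A (s k) (e b) = e (b \<noteq> flips t k)" for k b
    proof -
      \<comment> \<open>A permutation of a two-element set is determined by the image of
        \<open>x\<close>.\<close>
      have "out_map A (s k) x \<noteq> out_map A (s k) y"
        using bij_betw_imp_inj_on[OF bij[of k]] X by (simp add: inj_on_def)
      moreover have "out_map A (s k) x \<in> {x, y}" "out_map A (s k) y \<in> {x, y}"
        using bij_betwE[OF bij[of k]] X by simp_all
      ultimately show ?thesis
        using X(2) by (cases b) (auto simp: flips_def t_def e_def)
    qed
  qed (fact assms s e)+
  then show ?thesis
    using that by blast
qed

lemma group_automaton_group: "group (automaton_group A)"
  unfolding automaton_group_def by (rule group.group_subgroup_generated[OF group_tree_aut_group])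

lemma finite_automaton_groups_iso:
  fixes G :: "('x list \<Rightarrow> 'x list) monoid"
  assumes "G \<in> finite_automaton_groups_3_2 TYPE('q)"
  shows "G \<cong> singleton_group () \<or> G \<cong> C2 \<or> G \<cong> C2 \<times>\<times> C2 \<or> G \<cong> D4 \<or>
    G \<cong> C2 \<times>\<times> C2 \<times>\<times> C2 \<or> G \<cong> D4 \<times>\<times> C2"
proof -
  obtain A :: "('q, 'x) automaton" where A: "G = automaton_group A" "finite_invertible_automaton A"
    "card (states A) = 3" "card (alphabet A) = 2" "finite (carrier (automaton_group A))"
    using assms by (auto simp: finite_automaton_groups_3_2_def)
  obtain s e t where "coded_automaton A s e t"
    using coded_automaton_exists[OF A(2-4)] by blast
  then show ?thesis
    unfolding A(1) using A(5) by (rule coded_automaton.finite_automaton_group_iso)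
qed

section \<open>The six groups\<close>

lemma card_models:
  "card (carrier (singleton_group ())) = 1" "card (carrier C2) = 2" "card (carrier (C2 \<times>\<times> C2)) = 4"
  "card (carrier D4) = 8" "card (carrier (C2 \<times>\<times> C2 \<times>\<times> C2)) = 8" "card (carrier (D4 \<times>\<times> C2)) = 16"
  by (simp_all add: carrier_integer_mod_group dihedral_group_def card_cartesian_product)

context coded_automaton
begin

lemma automaton_group_eq3:
  "automaton_group A = subgroup_generated Aut {state_aut A (s Sa), state_aut A (s Sb), state_aut A (s Sc)}"
  unfolding automaton_group_eq UNIV_state3 by simp

lemma state_aut_trivial: "trivial_word t [q] \<Longrightarrow> state_aut A (s q) = \<one>\<^bsub>Aut\<^esub>"
  using word_aut_trivial[of "[q]"] by simp

lemma state_aut_involution: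
  "trivial_word t [q, q] \<Longrightarrow> state_aut A (s q) \<otimes>\<^bsub>Aut\<^esub> state_aut A (s q) = \<one>\<^bsub>Aut\<^esub>"
  using word_aut_trivial[of "[q, q]"] by simp

lemma state_auts_commute:
  assumes "trivial_word t [p, p]" "trivial_word t [q, q]" "trivial_word t [q, p, q, p]"
  shows "state_aut A (s p) \<otimes>\<^bsub>Aut\<^esub> state_aut A (s q) = state_aut A (s q) \<otimes>\<^bsub>Aut\<^esub> state_aut A (s p)"
  using assms word_aut_trivial[OF assms(3)]
  by (intro Aut.involutions_commute) (simp_all add: state_aut_involution Aut.m_assoc)

lemma state_auts_dihedral:
  assumes "trivial_word t [q, p, q, p, q, p, q, p]" "\<not> trivial_word t [q, p, q, p]"
  shows "(state_aut A (s p) \<otimes>\<^bsub>Aut\<^esub> state_aut A (s q)) [^]\<^bsub>Aut\<^esub> (4 :: nat) = \<one>\<^bsub>Aut\<^esub>"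
    and "(state_aut A (s p) \<otimes>\<^bsub>Aut\<^esub> state_aut A (s q)) [^]\<^bsub>Aut\<^esub> (2 :: nat) \<noteq> \<one>\<^bsub>Aut\<^esub>"
proof -
  show "(state_aut A (s p) \<otimes>\<^bsub>Aut\<^esub> state_aut A (s q)) [^]\<^bsub>Aut\<^esub> (4 :: nat) = \<one>\<^bsub>Aut\<^esub>"
    using word_aut_trivial[OF assms(1)] by (simp add: eval_nat_numeral Aut.m_assoc)
  have "word_aut [q, p, q, p] \<noteq> word_aut []"
    using assms(2) unfolding word_aut_eq_iff trivial_word_def by (metis run_word.simps(1))
  then show "(state_aut A (s p) \<otimes>\<^bsub>Aut\<^esub> state_aut A (s q)) [^]\<^bsub>Aut\<^esub> (2 :: nat) \<noteq> \<one>\<^bsub>Aut\<^esub>"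
    by (simp add: eval_nat_numeral Aut.m_assoc)
qed

text \<open>There are more group elements than \<open>H\<close> has. Positivity of the cardinality
  encodes that the carrier of \<open>H\<close> is finite, \<open>card\<close> being 0 on infinite
  sets.\<close>

lemma not_iso_if_words_distinct:
  assumes "distinct (map (\<lambda>w. map (run_word t w) us) ws)" "card (carrier H) < length ws" "card (carrier H) > 0"
  shows "\<not> automaton_group A \<cong> H"
proof
  assume iso: "automaton_group A \<cong> H"
  then have "finite (carrier (automaton_group A))"
    using assms(3) by (metis card_gt_0_iff iso_finite)
  then show False
    using card_automaton_group_ge assms iso_same_card[OF iso] by fastforce
qed

end

lemma coded_automaton3:
  "coded_automaton (automaton3 wa wb wc) id (\<lambda>b. if b then 1 else 0) (case_state3 wa wb wc)"
proof
  let ?A = "automaton3 wa wb wc"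
  show "finite_invertible_automaton ?A"
    by (rule automaton3_in_class)
  show "range id = states ?A"
    by (simp add: automaton3_def Let_def UNIV_state3)
  show "inj (\<lambda>b. if b then 1 else 0 :: nat)"
    by (simp add: inj_def)
  show "range (\<lambda>b. if b then 1 else 0 :: nat) = alphabet ?A"
    by (simp add: automaton3_def Let_def UNIV_bool insert_commute)
  show "out_map ?A (id q) (if b then 1 else 0) = (if b \<noteq> flips (case_state3 wa wb wc) q then 1 else 0)" for q b
    by (cases q) (auto simp: automaton3_def Let_def flips_def split: prod.split)
  show "trans_map ?A (id q) (if b then 1 else 0) = id (state_section (case_state3 wa wb wc) q b)" for q b
    by (cases q) (auto simp: automaton3_def Let_def state_section_def split: prod.split)
qed

lemma finite_models:
  "finite (carrier (singleton_group ()))" "finite (carrier C2)" "finite (carrier (C2 \<times>\<times> C2))"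
  "finite (carrier D4)" "finite (carrier (C2 \<times>\<times> C2 \<times>\<times> C2))" "finite (carrier (D4 \<times>\<times> C2))"
  using card_models by (simp_all add: card_ge_0_finite)

lemma automaton_1_iso: "automaton_group automaton_1 \<cong> singleton_group ()"
proof -
  define t where "t = case_state3 \<iota>(Sa, Sa) \<iota>(Sa, Sa) \<iota>(Sa, Sa)"
  interpret coded_automaton automaton_1 id "\<lambda>b. if b then 1 else 0" t
    unfolding automaton_1_def t_def by (rule coded_automaton3)
  have "trivial_word t [Sa]" and "trivial_word t [Sb]" and "trivial_word t [Sc]"
    unfolding t_def by (rule trivial_closure_sound[of 30], code_simp)+
  then have "automaton_group automaton_1 = subgroup_generated Aut {}"
    unfolding automaton_group_eq3 by (simp add: state_aut_trivial del: id_apply)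
  then show ?thesis
    using Aut.subgroup_generated_empty_iso by simp
qed

text \<open>The relations leave only a short list of candidate groups, and words with distinct
  images exclude the smaller ones. The automata 730, 802 and 748 are treated in the same
  way.\<close>

lemma automaton_1090_iso: "automaton_group automaton_1090 \<cong> C2"
proof -
  define t where "t = case_state3 \<sigma>(Sa, Sa) \<iota>(Sb, Sb) \<iota>(Sb, Sb)"
  interpret coded_automaton automaton_1090 id "\<lambda>b. if b then 1 else 0" t
    unfolding automaton_1090_def t_def by (rule coded_automaton3)
  have "trivial_word t [Sb]" and "trivial_word t [Sc]" and "trivial_word t [Sa, Sa]"
    unfolding t_def by (rule trivial_closure_sound[of 30], code_simp)+
  note triv = this
  have "automaton_group automaton_1090 = subgroup_generated Aut (insert \<one>\<^bsub>Aut\<^esub> {state_aut automaton_1090 (id Sa)})"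
    unfolding automaton_group_eq3 state_aut_trivial[OF triv(1)] state_aut_trivial[OF triv(2)] by (rule arg_cong[where f = "subgroup_generated Aut"]) blast
  also have "\<dots> = subgroup_generated Aut {state_aut automaton_1090 (id Sa)}"
    by (rule Aut.subgroup_generated_one) (simp add: state_aut_closed del: id_apply)
  finally have group: "automaton_group automaton_1090 = subgroup_generated Aut {state_aut automaton_1090 (id Sa)}" .
  have "distinct (map (\<lambda>w. map (run_word t w) [[False]]) [[], [Sa]])"
    unfolding t_def by code_simp
  then have "\<not> automaton_group automaton_1090 \<cong> singleton_group ()"
    by (rule not_iso_if_words_distinct) (simp_all only: card_models, simp_all)
  moreover have "automaton_group automaton_1090 \<cong> singleton_group () \<or> automaton_group automaton_1090 \<cong> C2"
    unfolding group by (intro Aut.one_involution_iso state_aut_involution state_aut_closed triv)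
  ultimately show ?thesis
    by blast
qed

lemma automaton_730_iso: "automaton_group automaton_730 \<cong> C2 \<times>\<times> C2"
proof -
  define t where "t = case_state3 \<sigma>(Sa, Sa) \<iota>(Sa, Sa) \<iota>(Sa, Sa)"
  interpret coded_automaton automaton_730 id "\<lambda>b. if b then 1 else 0" t
    unfolding automaton_730_def t_def by (rule coded_automaton3)
  have "trivial_word t [Sa, Sa]" and "trivial_word t [Sb, Sb]" and "trivial_word t [Sb, Sa, Sb, Sa]" and "trivial_word t [Sb, Sc]"
    unfolding t_def by (rule trivial_closure_sound[of 30], code_simp)+
  note triv = this
  \<comment> \<open>Both \<open>Sb\<close> and \<open>Sc\<close> are inverse to
    \<open>Sb\<close>.\<close>
  have "state_aut automaton_730 (id Sb) = state_aut automaton_730 (id Sc)"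
    using word_aut_trivial[OF triv(4)] state_aut_involution[OF triv(2)]
    by (metis Aut.inv_equality Aut.l_one word_aut.simps state_aut_closed)
  then have group: "automaton_group automaton_730 =
      subgroup_generated Aut {state_aut automaton_730 (id Sa), state_aut automaton_730 (id Sb)}"
    unfolding automaton_group_eq3 by (simp del: id_apply)
  have words: "distinct (map (\<lambda>w. map (run_word t w) [[False, False]]) [[], [Sa], [Sb], [Sa, Sb]])"
    unfolding t_def by code_simp
  have "\<not> automaton_group automaton_730 \<cong> singleton_group ()" "\<not> automaton_group automaton_730 \<cong> C2"
    by (rule not_iso_if_words_distinct[OF words]; simp only: card_models; simp)+
  moreover have "automaton_group automaton_730 \<cong> singleton_group () \<or> automaton_group automaton_730 \<cong> C2 \<or>
      automaton_group automaton_730 \<cong> C2 \<times>\<times> C2"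
    unfolding group by (intro Aut.two_involutions_iso state_aut_involution state_auts_commute state_aut_closed triv)
  ultimately show ?thesis
    by blast
qed

text \<open>\<open>Sb\<close> is trivial, and \<open>Sc\<close> changes the tail below the letter 1
  only; its conjugate by \<open>Sa\<close> changes the tail below 0. The square of the product of
  \<open>Sa\<close> and \<open>Sc\<close> therefore changes everything after the first letter, and
  that product has order 4.\<close>

lemma automaton_847_iso: "automaton_group automaton_847 \<cong> D4"
proof -
  define t where "t = case_state3 \<sigma>(Sa, Sa) \<iota>(Sb, Sb) \<iota>(Sb, Sa)"
  interpret coded_automaton automaton_847 id "\<lambda>b. if b then 1 else 0" t
    unfolding automaton_847_def t_def by (rule coded_automaton3)
  have "trivial_word t [Sb]" and "trivial_word t [Sa, Sa]" and "trivial_word t [Sc, Sc]" and "trivial_word t [Sc, Sa, Sc, Sa, Sc, Sa, Sc, Sa]"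
    unfolding t_def by (rule trivial_closure_sound[of 30], code_simp)+
  note triv = this
  have "automaton_group automaton_847 = subgroup_generated Aut (insert \<one>\<^bsub>Aut\<^esub> {state_aut automaton_847 (id Sa), state_aut automaton_847 (id Sc)})"
    unfolding automaton_group_eq3 state_aut_trivial[OF triv(1)] by (rule arg_cong[where f = "subgroup_generated Aut"]) blast
  also have "\<dots> = subgroup_generated Aut {state_aut automaton_847 (id Sa), state_aut automaton_847 (id Sc)}"
    by (rule Aut.subgroup_generated_one) (simp add: state_aut_closed del: id_apply)
  finally have group: "automaton_group automaton_847 = subgroup_generated Aut {state_aut automaton_847 (id Sa), state_aut automaton_847 (id Sc)}" .
  have "run_word t [Sc, Sa, Sc, Sa] [False, False] \<noteq> [False, False]"
    unfolding t_def by code_simp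
  then have nontriv: "\<not> trivial_word t [Sc, Sa, Sc, Sa]"
    unfolding trivial_word_def by blast
  show ?thesis
    unfolding group
    by (intro Aut.dihedral_subgroup_generated state_aut_involution state_auts_dihedral state_aut_closed triv nontriv)
qed

text \<open>\<open>Sa\<close> changes all letters, \<open>Sc\<close> all but the first, and
  \<open>Sb\<close> all from the third on. One input of length three thus separates the eight
  products.\<close>

lemma automaton_802_iso: "automaton_group automaton_802 \<cong> C2 \<times>\<times> C2 \<times>\<times> C2"
proof -
  define t where "t = case_state3 \<sigma>(Sa, Sa) \<iota>(Sc, Sc) \<iota>(Sa, Sa)"
  interpret coded_automaton automaton_802 id "\<lambda>b. if b then 1 else 0" t
    unfolding automaton_802_def t_def by (rule coded_automaton3)
  have "trivial_word t [Sa, Sa]" and "trivial_word t [Sb, Sb]" and "trivial_word t [Sc, Sc]" and "trivial_word t [Sb, Sa, Sb, Sa]" and "trivial_word t [Sc, Sa, Sc, Sa]" and "trivial_word t [Sc, Sb, Sc, Sb]"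
    unfolding t_def by (rule trivial_closure_sound[of 30], code_simp)+
  note triv = this
  have words: "distinct (map (\<lambda>w. map (run_word t w) [[False, False, False]])
      [[], [Sa], [Sb], [Sa, Sb], [Sc], [Sa, Sc], [Sb, Sc], [Sa, Sb, Sc]])"
    unfolding t_def by code_simp
  have "\<not> automaton_group automaton_802 \<cong> singleton_group ()" "\<not> automaton_group automaton_802 \<cong> C2"
    "\<not> automaton_group automaton_802 \<cong> C2 \<times>\<times> C2"
    by (rule not_iso_if_words_distinct[OF words]; simp only: card_models; simp)+
  moreover have "automaton_group automaton_802 \<cong> singleton_group () \<or> automaton_group automaton_802 \<cong> C2 \<or>
      automaton_group automaton_802 \<cong> C2 \<times>\<times> C2 \<or> automaton_group automaton_802 \<cong> C2 \<times>\<times> C2 \<times>\<times> C2"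
    unfolding automaton_group_eq3
    by (intro Aut.three_involutions_iso state_aut_involution state_auts_commute state_aut_closed triv)
  ultimately show ?thesis
    by blast
qed

lemma automaton_748_iso: "automaton_group automaton_748 \<cong> D4 \<times>\<times> C2"
proof -
  define t where "t = case_state3 \<sigma>(Sa, Sa) \<iota>(Sc, Sa) \<iota>(Sa, Sa)"
  interpret coded_automaton automaton_748 id "\<lambda>b. if b then 1 else 0" t
    unfolding automaton_748_def t_def by (rule coded_automaton3)
  have "trivial_word t [Sa, Sa]" and "trivial_word t [Sb, Sb]" and "trivial_word t [Sc, Sc]" and "trivial_word t [Sb, Sa, Sb, Sa, Sb, Sa, Sb, Sa]" and "trivial_word t [Sc, Sa, Sc, Sa]" and "trivial_word t [Sc, Sb, Sc, Sb]"
    unfolding t_def by (rule trivial_closure_sound[of 30], code_simp)+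
  note triv = this
  \<comment> \<open>The eight elements of the dihedral group generated by \<open>Sa\<close> and
    \<open>Sb\<close>, first without and then with the central \<open>Sc\<close>.\<close>
  have words: "distinct (map (\<lambda>w. map (run_word t w) [[False, False, False], [True, False, False]])
      [[], [Sa], [Sb], [Sa, Sb], [Sb, Sa], [Sa, Sb, Sa], [Sb, Sa, Sb], [Sa, Sb, Sa, Sb],
       [Sc], [Sa, Sc], [Sb, Sc], [Sa, Sb, Sc], [Sb, Sa, Sc], [Sa, Sb, Sa, Sc], [Sb, Sa, Sb, Sc],
       [Sa, Sb, Sa, Sb, Sc]])"
    unfolding t_def by code_simp
  have "run_word t [Sb, Sa, Sb, Sa] [False, False] \<noteq> [False, False]"
    unfolding t_def by code_simp
  then have nontriv: "\<not> trivial_word t [Sb, Sa, Sb, Sa]"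
    unfolding trivial_word_def by blast
  have "\<not> automaton_group automaton_748 \<cong> D4"
    by (rule not_iso_if_words_distinct[OF words]; simp only: card_models; simp)
  moreover have "automaton_group automaton_748 \<cong> D4 \<or> automaton_group automaton_748 \<cong> D4 \<times>\<times> C2"
    unfolding automaton_group_eq3
    by (intro Aut.dihedral_central_involution_iso state_aut_involution state_auts_commute
        state_auts_dihedral state_aut_closed triv nontriv)
  ultimately show ?thesis
    by blast
qed

section \<open>Counting the isomorphism classes\<close>

text \<open>The classes are the nonempty fibres of \<open>f\<close>, one for each value.\<close>

lemma card_quotient_kernel:
  "card (A // {(x, y). x \<in> A \<and> y \<in> A \<and> f x = f y}) = card (f ` A)"
proof -
  let ?c = "\<lambda>v. {x \<in> A. f x = v}"
  have "A // {(x, y). x \<in> A \<and> y \<in> A \<and> f x = f y} = ?c ` f ` A"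
  proof -
    have "{(x, y). x \<in> A \<and> y \<in> A \<and> f x = f y} `` {x} = ?c (f x)" if "x \<in> A" for x
      using that by auto
    then show ?thesis
      unfolding quotient_def by auto
  qed
  moreover have "inj_on ?c (f ` A)"
    by (auto simp: inj_on_def)
  ultimately show ?thesis
    by (simp add: card_image)
qed

text \<open>The second component is only needed to separate \<open>D\<^sub>4\<close> from \<open>C\<^sub>2 \<times> C\<^sub>2 \<times> C\<^sub>2\<close>.\<close>

definition order_and_exponent :: "('a, 'm) monoid_scheme \<Rightarrow> nat \<times> bool" where
  "order_and_exponent G = (card (carrier G), \<forall>g\<in>carrier G. g \<otimes>\<^bsub>G\<^esub> g = \<one>\<^bsub>G\<^esub>)"

lemma exponent_two_iso:
  assumes "G \<cong> H" "group G" "group H" and sq: "\<forall>g\<in>carrier G. g \<otimes>\<^bsub>G\<^esub> g = \<one>\<^bsub>G\<^esub>"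
  shows "\<forall>h\<in>carrier H. h \<otimes>\<^bsub>H\<^esub> h = \<one>\<^bsub>H\<^esub>"
proof
  fix h assume "h \<in> carrier H"
  moreover obtain \<phi> where \<phi>: "\<phi> \<in> hom G H" "\<phi> ` carrier G = carrier H"
    using assms(1) by (auto simp: is_iso_def iso_iff)
  ultimately obtain g where g: "g \<in> carrier G" "h = \<phi> g"
    by blast
  then have "h \<otimes>\<^bsub>H\<^esub> h = \<phi> (g \<otimes>\<^bsub>G\<^esub> g)"
    using \<phi>(1) by (simp add: hom_mult)
  also have "\<dots> = \<one>\<^bsub>H\<^esub>"
    using sq g(1) hom_one[OF \<phi>(1)] assms by simp
  finally show "h \<otimes>\<^bsub>H\<^esub> h = \<one>\<^bsub>H\<^esub>" .
qed

lemma order_and_exponent_iso: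
  assumes "G \<cong> H" "group G" "group H"
  shows "order_and_exponent G = order_and_exponent H"
  using iso_same_card[OF assms(1)] exponent_two_iso[OF assms]
    exponent_two_iso[OF group.iso_sym[OF assms(2,1)] assms(3,2)]
  unfolding order_and_exponent_def by blast

lemma order_and_exponent_models:
  "order_and_exponent (singleton_group ()) = (1, True)" "order_and_exponent C2 = (2, True)"
  "order_and_exponent (C2 \<times>\<times> C2) = (4, True)" "order_and_exponent D4 = (8, False)"
  "order_and_exponent (C2 \<times>\<times> C2 \<times>\<times> C2) = (8, True)" "order_and_exponent (D4 \<times>\<times> C2) = (16, False)"
proof -
  have C2: "carrier C2 = {0, 1}"
    by (auto simp: carrier_integer_mod_group)
  have D4: "(1, False) \<in> carrier D4" "(1, False) \<otimes>\<^bsub>D4\<^esub> (1, False) \<noteq> \<one>\<^bsub>D4\<^esub>"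
    by (simp_all add: dihedral_group_def)
  moreover from D4 have "((1, False), 0) \<in> carrier (D4 \<times>\<times> C2)"
    "((1, False), 0) \<otimes>\<^bsub>D4 \<times>\<times> C2\<^esub> ((1, False), 0) \<noteq> \<one>\<^bsub>D4 \<times>\<times> C2\<^esub>"
    by (simp_all add: C2)
  ultimately show "order_and_exponent D4 = (8, False)" "order_and_exponent (D4 \<times>\<times> C2) = (16, False)"
    unfolding order_and_exponent_def card_models by blast+
  show "order_and_exponent (singleton_group ()) = (1, True)"
    unfolding order_and_exponent_def card_models by (simp add: singleton_group_def)
  show "order_and_exponent C2 = (2, True)" "order_and_exponent (C2 \<times>\<times> C2) = (4, True)"
    "order_and_exponent (C2 \<times>\<times> C2 \<times>\<times> C2) = (8, True)"
    unfolding order_and_exponent_def card_models by (simp_all add: C2)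
qed

lemma group_models:
  "group (singleton_group ())" "group C2" "group (C2 \<times>\<times> C2)" "group D4"
  "group (C2 \<times>\<times> C2 \<times>\<times> C2)" "group (D4 \<times>\<times> C2)"
  by (simp_all add: DirProd_group group_dihedral_group)

lemma order_and_exponent_eq:
  assumes "group G"
  shows "G \<cong> singleton_group () \<Longrightarrow> order_and_exponent G = (1, True)"
    and "G \<cong> C2 \<Longrightarrow> order_and_exponent G = (2, True)"
    and "G \<cong> C2 \<times>\<times> C2 \<Longrightarrow> order_and_exponent G = (4, True)"
    and "G \<cong> D4 \<Longrightarrow> order_and_exponent G = (8, False)"
    and "G \<cong> C2 \<times>\<times> C2 \<times>\<times> C2 \<Longrightarrow> order_and_exponent G = (8, True)"
    and "G \<cong> D4 \<times>\<times> C2 \<Longrightarrow> order_and_exponent G = (16, False)"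
  using group_models[THEN order_and_exponent_iso[OF _ assms, rotated]]
  unfolding order_and_exponent_models by blast+

lemma iso_via:
  assumes "G \<cong> M" "H \<cong> M" "group H"
  shows "G \<cong> H"
  using assms group.iso_sym iso_trans by blast

lemmas automaton_defs =
  automaton_1_def automaton_1090_def automaton_730_def automaton_847_def automaton_802_def automaton_748_def

text \<open>On these groups \<open>order_and_exponent\<close> is a complete isomorphism invariant,
  so the classes are counted by its values.\<close>

lemma card_iso_classes:
  "card ((finite_automaton_groups_3_2 TYPE(state3) :: (nat list \<Rightarrow> nat list) monoid set) //
     iso_rel (finite_automaton_groups_3_2 TYPE(state3))) = 6"
proof -
  let ?\<G> = "finite_automaton_groups_3_2 TYPE(state3) :: (nat list \<Rightarrow> nat list) monoid set"
  let ?f = "order_and_exponent :: (nat list \<Rightarrow> nat list) monoid \<Rightarrow> _"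
  let ?V = "{(1, True), (2, True), (4, True), (8, False), (8, True), (16, False)} :: (nat \<times> bool) set"
  have group: "group G" if "G \<in> ?\<G>" for G
    using that group_automaton_group by (auto simp: finite_automaton_groups_3_2_def)
  have cases: "?f G = (1, True) \<and> G \<cong> singleton_group () \<or> ?f G = (2, True) \<and> G \<cong> C2 \<or>
      ?f G = (4, True) \<and> G \<cong> C2 \<times>\<times> C2 \<or> ?f G = (8, False) \<and> G \<cong> D4 \<or>
      ?f G = (8, True) \<and> G \<cong> C2 \<times>\<times> C2 \<times>\<times> C2 \<or> ?f G = (16, False) \<and> G \<cong> D4 \<times>\<times> C2" if "G \<in> ?\<G>" for G
    using finite_automaton_groups_iso[OF that] order_and_exponent_eq[OF group[OF that]] by blast
  have range: "?f G \<in> ?V" if "G \<in> ?\<G>" for G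
    using cases[OF that] by (elim disjE conjE) simp_all
  \<comment> \<open>By the classification, the value of \<open>?f\<close> determines the model, and
    two groups with the same model are isomorphic.\<close>
  have "iso_rel ?\<G> = {(G, H). G \<in> ?\<G> \<and> H \<in> ?\<G> \<and> ?f G = ?f H}"
  proof -
    have iso: "?f G = (1, True) \<Longrightarrow> G \<cong> singleton_group ()" "?f G = (2, True) \<Longrightarrow> G \<cong> C2"
      "?f G = (4, True) \<Longrightarrow> G \<cong> C2 \<times>\<times> C2" "?f G = (8, False) \<Longrightarrow> G \<cong> D4"
      "?f G = (8, True) \<Longrightarrow> G \<cong> C2 \<times>\<times> C2 \<times>\<times> C2" "?f G = (16, False) \<Longrightarrow> G \<cong> D4 \<times>\<times> C2"
      if "G \<in> ?\<G>" for G
      using cases[OF that] by auto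
    have "G \<cong> H" if G: "G \<in> ?\<G>" and H: "H \<in> ?\<G>" and eq: "?f H = ?f G" for G H
      using range[OF G]
    proof (elim insertE emptyE)
      show "?f G = (1, True) \<Longrightarrow> G \<cong> H"
        by (rule iso_via[OF iso(1)[OF G] iso(1)[OF H] group[OF H]]) (simp_all only: eq)
      show "?f G = (2, True) \<Longrightarrow> G \<cong> H"
        by (rule iso_via[OF iso(2)[OF G] iso(2)[OF H] group[OF H]]) (simp_all only: eq)
      show "?f G = (4, True) \<Longrightarrow> G \<cong> H"
        by (rule iso_via[OF iso(3)[OF G] iso(3)[OF H] group[OF H]]) (simp_all only: eq)
      show "?f G = (8, False) \<Longrightarrow> G \<cong> H"
        by (rule iso_via[OF iso(4)[OF G] iso(4)[OF H] group[OF H]]) (simp_all only: eq)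
      show "?f G = (8, True) \<Longrightarrow> G \<cong> H"
        by (rule iso_via[OF iso(5)[OF G] iso(5)[OF H] group[OF H]]) (simp_all only: eq)
      show "?f G = (16, False) \<Longrightarrow> G \<cong> H"
        by (rule iso_via[OF iso(6)[OF G] iso(6)[OF H] group[OF H]]) (simp_all only: eq)
    qed
    moreover have "?f G = ?f H" if "G \<in> ?\<G>" "H \<in> ?\<G>" "G \<cong> H" for G H
      using order_and_exponent_iso[OF that(3) group[OF that(1)] group[OF that(2)]] .
    ultimately show ?thesis
      unfolding iso_rel_def by blast
  qed
  then have "card (?\<G> // iso_rel ?\<G>) = card (?f ` ?\<G>)"
    by (simp add: card_quotient_kernel)
  \<comment> \<open>Each of the six values is attained by one of the six numbered automata.\<close>
  also have "?f ` ?\<G> = ?V"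
  proof
    show "?f ` ?\<G> \<subseteq> ?V"
      using range by (rule image_subsetI)
    have mem: "automaton_group (automaton3 wa wb wc) \<in> ?\<G>"
      if "finite (carrier (automaton_group (automaton3 wa wb wc)))" for wa wb wc
      using that automaton3_in_class unfolding finite_automaton_groups_3_2_def by blast
    have "?f (automaton_group A) \<in> ?f ` ?\<G>"
      if A: "A \<in> {automaton_1, automaton_1090, automaton_730, automaton_847, automaton_802, automaton_748}" for A
    proof -
      have "finite (carrier (automaton_group A))"
        using A finite_models iso_finite[OF automaton_1_iso] iso_finite[OF automaton_1090_iso]
          iso_finite[OF automaton_730_iso] iso_finite[OF automaton_847_iso]
          iso_finite[OF automaton_802_iso] iso_finite[OF automaton_748_iso] by auto
      moreover obtain wa wb wc where "A = automaton3 wa wb wc"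
        using A unfolding automaton_defs by blast
      ultimately have "automaton_group A \<in> ?\<G>"
        using mem by simp
      then show ?thesis
        by (rule imageI)
    qed
    note this[of automaton_1] this[of automaton_1090] this[of automaton_730] this[of automaton_847]
      this[of automaton_802] this[of automaton_748]
    moreover have "?f (automaton_group automaton_1) = (1, True)" "?f (automaton_group automaton_1090) = (2, True)"
      "?f (automaton_group automaton_730) = (4, True)" "?f (automaton_group automaton_847) = (8, False)"
      "?f (automaton_group automaton_802) = (8, True)" "?f (automaton_group automaton_748) = (16, False)"
      using automaton_1_iso automaton_1090_iso automaton_730_iso automaton_847_iso automaton_802_iso
        automaton_748_iso order_and_exponent_eq[OF group_automaton_group] by blast+
    ultimately show "?V \<subseteq> ?f ` ?\<G>"
      by simp
  qed
  also have "card ?V = 6"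
    by simp
  finally show ?thesis .
qed

theorem theorem3:
  shows "(\<forall>G \<in> (finite_automaton_groups_3_2 TYPE('q) :: ('x list \<Rightarrow> 'x list) monoid set).
            G \<cong> singleton_group () \<or> G \<cong> C2 \<or> G \<cong> C2 \<times>\<times> C2 \<or> G \<cong> D4 \<or>
            G \<cong> C2 \<times>\<times> C2 \<times>\<times> C2 \<or> G \<cong> D4 \<times>\<times> C2) \<and>
         (let \<G> = (finite_automaton_groups_3_2 TYPE(state3) :: (nat list \<Rightarrow> nat list) monoid set)
          in card (\<G> // iso_rel \<G>) = 6) \<and>
         automaton_group automaton_1 \<cong> singleton_group () \<and>
         automaton_group automaton_1090 \<cong> C2 \<and>
         automaton_group automaton_730 \<cong> C2 \<times>\<times> C2 \<and>
         automaton_group automaton_847 \<cong> D4 \<and>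
         automaton_group automaton_802 \<cong> C2 \<times>\<times> C2 \<times>\<times> C2 \<and>
         automaton_group automaton_748 \<cong> D4 \<times>\<times> C2"
  unfolding Let_def
  by (intro conjI ballI finite_automaton_groups_iso card_iso_classes automaton_1_iso automaton_1090_iso
      automaton_730_iso automaton_847_iso automaton_802_iso automaton_748_iso)

end
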